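(* Let $(\mathsf H, L)$ be a canonical system and let $0<d<1$. 1. Suppose that there exists a $C>0$ such that for each sufficiently large $R$ there exist a Hamiltonian $\mathsf H_R$ of finite rank $N=N(R)$ defined on $(0,L)$, with parameters $0=x_0<x_1<\dots<x_N=L$ and unit vectors $e_0,\dots,e_{N-1}\in\mathbb R^2$, and numbers $a_0,\dots,a_{N-1}$ with $0<a_j\le 1$ (the parameters and the $a_j$ may depend on $R$), such that, with $P_j=\langle\cdot,e_j\rangle e_j$, (i) $\displaystyle \sum_{j=0}^{N-1}\frac1{a_j^2}\int_{x_j}^{x_{j+1}}\|\mathsf H(t)-\mathsf H_R(t)\|\,dt\le C R^{d-1}$, (ii) $\displaystyle \sum_{j=0}^{N-1}a_j^2(x_{j+1}-x_j)\le C R^{d-1}$, (iii) $\displaystyle \sum_{j=0}^{N-2}\log\left(1+\frac{\|P_j-P_{j+1}\|}{a_ja_{j+1}}\right)\le C R^{d}$, (iv) $\displaystyle \log a_0^{-1}+\log a_{N-1}^{-1}+\sum_{j=1}^{N-1}\left|\log\frac{a_j}{a_{j-1}}\right|\le C R^{d}$. Then there exists a $K>0$ such that the monodromy matrix $M(z)$ of $(\mathsf H,L)$ satisfies $\|M(z)\|\le e^{K|z|^d}$ for all $z\in\mathbb C$. 2. For each $p$ with $0<p<1$ there exists a canonical system $(\mathsf H,L)$ of order $p$ which, for every $\varepsilon>0$ with $p+\varepsilon<1$, satisfies the assumption of part 1 with $d=p+\varepsilon$.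
   Context: Canonical systems. Let $L>0$ and let $\mathsf H$ be a summable function on $[0,L]$ with values in $2\times2$ matrices such that $\mathsf H(x)\ge0$ and $\operatorname{tr}\mathsf H(x)=1$ for a.e. $x$. Let $J=\begin{pmatrix}0&-1\\1&0\end{pmatrix}$. The canonical system $(\mathsf H,L)$ is the equation $J\frac{dY}{dx}=z\mathsf H Y$, $z\in\mathbb C$, $x\in[0,L]$; $\mathsf H$ is called its Hamiltonian. Its matrix solution with $M(0,z)=I$ is denoted $M(x,z)$, and $M(z):=M(L,z)$ is the monodromy matrix, an entire matrix function of $z$. Order. The quantity $\limsup_{|z|\to\infty}\frac{\log\log|M_{ij}(z)|}{\log|z|}$ (the order of the entire function $M_{ij}$) does not depend on $i,j$ and is called the order of the system; it equals the order of the entire matrix function $M(z)$, i.e. $\limsup_{|z|\to\infty}\frac{\log\log\|M(z)\|}{\log|z|}$ (polynomials having order $0$). Finite rank Hamiltonians. A Hamiltonian $\mathsf G$ on $(0,L)$ is of finite rank if there exist numbers $0=x_0<x_1<\dots<x_N=L$ and unit vectors $e_0,\dots,e_{N-1}\in\mathbb R^2$ such that $\mathsf G(x)=\langle\cdot,e_j\rangle_{\mathbb C^2}e_j$ for $x\in(x_j,x_{j+1})$, $j=0,\dots,N-1$. The $x_j$, $e_j$ are called the parameters and $N$ the rank of $\mathsf G$; it is not required that $e_j\ne e_{j+1}$, so the rank is not uniquely defined. $\|\cdot\|$ is the operator norm of $2\times2$ matrices. *)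

theory Defs
  imports "HOL-Analysis.Analysis"
begin

text \<open>The type constructor \<open>^\<close> gives \<^typ>\<open>complex^2\<close> the Euclidean (that is, Hermitian) norm,
  but its library inner product is the real one; \<open>cdot\<close> is the Hermitian form, linear in the
  first argument.\<close>

definition cdot :: "complex^2 \<Rightarrow> complex^2 \<Rightarrow> complex" where
  "cdot v w = (\<Sum>i\<in>UNIV. v $ i * cnj (w $ i))"

text \<open>The library norm on matrices is the Hilbert--Schmidt one, hence a separate operator norm.\<close>

definition opnorm :: "complex^2^2 \<Rightarrow> real" where
  "opnorm A = onorm (\<lambda>v. A *v v)"

text \<open>Over the complex numbers, having a real nonnegative quadratic form forces self-adjointness.\<close>

definition psd :: "complex^2^2 \<Rightarrow> bool" where
  "psd A \<longleftrightarrow> (\<forall>v. cdot (A *v v) v \<in> \<real>\<^sub>\<ge>\<^sub>0)"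

definition J :: "complex^2^2" where
  "J = vector [vector [0, -1], vector [1, 0]]"

definition canonical_system :: "(real \<Rightarrow> complex^2^2) \<Rightarrow> real \<Rightarrow> bool" where
  "canonical_system H L \<longleftrightarrow>
     L > 0 \<and> integrable (lebesgue_on {0..L}) H \<and>
     (AE x in lebesgue_on {0..L}. psd (H x) \<and> trace (H x) = 1)"

text \<open>Classical absolute continuity. A set \<open>D\<close> with \<open>D division_of \<Union>D\<close> is a finite family of
  compact intervals (possibly points) with pairwise disjoint interiors.\<close>

definition absolutely_continuous_on :: "real set \<Rightarrow> (real \<Rightarrow> 'a::real_normed_vector) \<Rightarrow> bool" where
  "absolutely_continuous_on S f \<longleftrightarrow>
     (\<forall>\<epsilon>>0. \<exists>\<delta>>0. \<forall>D. D division_of \<Union>D \<and> \<Union>D \<subseteq> S \<and> (\<Sum>I\<in>D. Sup I - Inf I) < \<delta> \<longrightarrow>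
        (\<Sum>I\<in>D. norm (f (Sup I) - f (Inf I))) < \<epsilon>)"

text \<open>Since the Hamiltonian is only summable, the differential equation is understood in the sense
  of Caratheodory. Note that \<open>mat z ** A\<close> is the scalar multiple of \<open>A\<close> by \<open>z\<close>.\<close>

definition matrix_solution ::
  "(real \<Rightarrow> complex^2^2) \<Rightarrow> real \<Rightarrow> complex \<Rightarrow> (real \<Rightarrow> complex^2^2) \<Rightarrow> bool" where
  "matrix_solution H L z M \<longleftrightarrow>
     absolutely_continuous_on {0..L} M \<and> M 0 = mat 1 \<and>
     (AE x in lebesgue_on {0..L}.
        \<exists>D. (M has_vector_derivative D) (at x within {0..L}) \<and>
            J ** D = mat z ** (H x ** M x))"

definition monodromy :: "(real \<Rightarrow> complex^2^2) \<Rightarrow> real \<Rightarrow> complex \<Rightarrow> complex^2^2" where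
  "monodromy H L z = (THE A. \<exists>M. matrix_solution H L z M \<and> A = M L)"

text \<open>The case distinction is needed because the library logarithm is even, so that
  \<open>ln (ln t)\<close> would be meaningless for \<open>t \<le> 1\<close>; there the iterated logarithm is taken to be
  \<open>-\<infinity>\<close>. The maximum with \<open>0\<close> matters for constant functions only (order 0 by convention).\<close>

definition entire_order :: "(complex \<Rightarrow> complex^2^2) \<Rightarrow> ereal" where
  "entire_order F = max 0 (Limsup at_infinity (\<lambda>z.
     if opnorm (F z) > 1 then ereal (ln (ln (opnorm (F z))) / ln (norm z)) else -\<infinity>))"

definition system_order :: "(real \<Rightarrow> complex^2^2) \<Rightarrow> real \<Rightarrow> ereal" where
  "system_order H L = entire_order (monodromy H L)"

definition cvec :: "real^2 \<Rightarrow> complex^2" where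
  "cvec e = (\<chi> i. complex_of_real (e $ i))"

definition rank_one :: "real^2 \<Rightarrow> complex^2^2" where
  "rank_one e = matrix (\<lambda>v. cdot v (cvec e) *s cvec e)"

text \<open>The values of \<open>G\<close> at the nodes \<open>x j\<close> and outside \<open>{0..L}\<close> are unconstrained.\<close>

definition finite_rank_hamiltonian ::
  "real \<Rightarrow> nat \<Rightarrow> (nat \<Rightarrow> real) \<Rightarrow> (nat \<Rightarrow> real^2) \<Rightarrow> (real \<Rightarrow> complex^2^2) \<Rightarrow> bool" where
  "finite_rank_hamiltonian L N x e G \<longleftrightarrow>
     x 0 = 0 \<and> x N = L \<and> (\<forall>j<N. x j < x (Suc j)) \<and> (\<forall>j<N. norm (e j) = 1) \<and>
     (\<forall>j<N. \<forall>t\<in>{x j<..<x (Suc j)}. G t = rank_one (e j))"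

definition finite_rank_approximable :: "(real \<Rightarrow> complex^2^2) \<Rightarrow> real \<Rightarrow> real \<Rightarrow> bool" where
  "finite_rank_approximable H L d \<longleftrightarrow>
     (\<exists>C>0. \<forall>\<^sub>F R in at_top. \<exists>N x e G a.
        finite_rank_hamiltonian L N x e G \<and>
        (\<forall>j<N. 0 < a j \<and> a j \<le> 1) \<and>
        (\<Sum>j<N. 1 / (a j)\<^sup>2 *
            integral\<^sup>L (lebesgue_on {x j..x (Suc j)}) (\<lambda>t. opnorm (H t - G t)))
          \<le> C * R powr (d - 1) \<and>
        (\<Sum>j<N. (a j)\<^sup>2 * (x (Suc j) - x j)) \<le> C * R powr (d - 1) \<and>
        (\<Sum>j<N - 1. ln (1 + opnorm (rank_one (e j) - rank_one (e (Suc j))) / (a j * a (Suc j))))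
          \<le> C * R powr d \<and>
        ln (1 / a 0) + ln (1 / a (N - 1)) + (\<Sum>j\<in>{1..<N}. \<bar>ln (a j / a (j - 1))\<bar>)
          \<le> C * R powr d)"

lemma rank_one_apply: "rank_one e *v v = cdot v (cvec e) *s cvec e"
  by (simp add: rank_one_def vec_eq_iff matrix_vector_mult_def matrix_def cdot_def sum_2
      axis_def forall_2 algebra_simps)

end

theory Submission
  imports Defs
begin

text \<open>Part 1. On each interval where the approximant equals the projection \<open>P\<close> onto \<open>e\<close>, measure
  the solution in the norm \<open>\<bar>a\<^sup>-\<^sup>1 P v + a (v - P v)\<bar>\<close>. Since \<open>P J P = 0\<close>, this gauge turns \<open>z P\<close> into a term
  of size \<open>\<bar>z\<bar> a\<^sup>2\<close>, while the error \<open>z (H - P)\<close> grows by at most \<open>a\<^sup>-\<^sup>2\<close>. Gronwall's inequality then bounds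
  the growth on the interval, passing from one interval to the next costs at most
  \<open>\<bar>ln (a'/a)\<bar> + ln (1 + \<bar>P - P'\<bar> / (a a'))\<close> in the exponent, and the four hypotheses control the total.

  Part 2. With \<open>b = 1/p - 1\<close>, let the Hamiltonian on \<open>[0,1]\<close> alternate between the two coordinate
  projections, switching at the points \<open>1 - (k+1)\<^sup>-\<^sup>b\<close>. Keeping the first \<open>R\<^sup>p\<close> steps approximates it well
  enough for every exponent above \<open>p\<close>, so its order is at most \<open>p\<close>. At \<open>z = iy\<close> the transfer matrices are
  nonnegative in a suitable basis, and every two of the first \<open>c y\<^sup>p\<close> steps double an entry, so the
  order is at least \<open>p\<close>.\<close>

text \<open>For a given z the approximant is taken with R = |z|. The factor |z| turns the R^(d-1) of
  (i) and (ii) into R^d, so each hypothesis adds at most C |z|^d to the exponent; below the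
  threshold for R a crude bound exp (c |z|) suffices once K is enlarged.

  An obstacle is that \<open>monodromy\<close> is a definite description over functions solving the
  equation only almost everywhere. Existence and uniqueness come from the equivalent integral
  equation. The passage between the two forms needs almost everywhere differentiation of indefinite
  integrals one way and the fundamental theorem for absolutely continuous functions the other way.

  The exponent b balances two demands. The k-th step has length of order k^(-b-1), so |z| times it
  stays above a constant for about |z|^(1/(b+1)) = |z|^p steps. The tail beyond R^p steps has length
  about R^(-p b) = R^(p-1), within what (i) and (ii) allow. The price is paid in (iii): about R^p
  junctions each cost a multiple of log R, which fits under R^d for every d above p.\<close>

hide_const (open) Polynomial.content

section \<open>Absolute continuity and the Lebesgue differentiation theorem\<close>

lemma cball_midpoint_real:
  fixes x y :: real
  shows "cball ((x + y) / 2) (\<bar>y - x\<bar> / 2) = {min x y..max x y}"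
proof -
  have "(x + y) / 2 - \<bar>y - x\<bar> / 2 = min x y" "(x + y) / 2 + \<bar>y - x\<bar> / 2 = max x y"
    by (simp_all add: min_def max_def abs_if field_simps)
  then show ?thesis unfolding cball_eq_atLeastAtMost by simp
qed

lemma indefinite_integral_diff_real:
  fixes f :: "real \<Rightarrow> 'b::banach"
  assumes f: "f integrable_on {a..b}" and "x \<in> {a..b}" "y \<in> {a..b}" "x \<le> y"
  shows "integral {a..y} f - integral {a..x} f = integral {x..y} f"
proof -
  have "integral {a..x} f + integral {x..y} f = integral {a..y} f"
    using assms by (intro Henstock_Kurzweil_Integration.integral_combine integrable_on_subinterval[OF f]) auto
  then show ?thesis by (simp add: algebra_simps)
qed

text \<open>Saks--Henstock bounds the total length of disjoint fine intervals on which the difference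
  quotient is off by \<open>c\<close>; the Vitali covering theorem turns this into a bound on the outer measure.\<close>

lemma negligible_bad_difference_quotient:
  fixes f :: "real \<Rightarrow> 'b::euclidean_space"
  assumes f: "f integrable_on {a..b}" and c: "c > 0"
  shows "negligible {x \<in> {a..b}. \<forall>d>0. \<exists>y\<in>{a..b}. y \<noteq> x \<and> \<bar>y - x\<bar> < d \<and>
           norm (integral {a..y} f - integral {a..x} f - (y - x) *\<^sub>R f x) > c * \<bar>y - x\<bar>}"
    (is "negligible ?E")
  unfolding negligible_outer_le
proof (intro allI impI)
  let ?F = "\<lambda>x. integral {a..x} f"
  let ?bad = "\<lambda>x y. norm (?F y - ?F x - (y - x) *\<^sub>R f x) > c * \<bar>y - x\<bar>"
  fix e :: real assume e: "e > 0"
  have "f integrable_on cbox a b" using f by simp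
  \<comment> \<open>The tolerance is e * c because every bad interval will be charged at least c
    times its length.\<close>
  from Henstock_lemma[OF this, of "e * c"] e c obtain \<gamma> where \<gamma>: "gauge \<gamma>"
    and H: "\<And>p. \<lbrakk>p tagged_partial_division_of (cbox a b); \<gamma> fine p\<rbrakk> \<Longrightarrow>
             sum (\<lambda>(x,k). norm(content k *\<^sub>R f x - integral k f)) p < e * c" by auto
  \<comment> \<open>The base point x is an endpoint of its interval, while the covering theorem
    wants closed balls; on the line the interval is the ball about its midpoint.\<close>
  define I where "I = (\<lambda>(x::real,y). {min x y..max x y})"
  define K where "K = {(x,y). x \<in> ?E \<and> y \<in> {a..b} \<and> y \<noteq> x \<and> ?bad x y \<and> I (x,y) \<subseteq> \<gamma> x}"
  have I: "I i = cball ((fst i + snd i)/2) (\<bar>snd i - fst i\<bar>/2)" for i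
    by (simp add: I_def cball_midpoint_real split: prod.splits)
  have v1: "0 < \<bar>snd i - fst i\<bar>/2" if "i \<in> K" for i using that by (auto simp: K_def)
  have v2: "\<exists>i. i \<in> K \<and> x \<in> cball ((fst i + snd i)/2) (\<bar>snd i - fst i\<bar>/2) \<and> \<bar>snd i - fst i\<bar>/2 < d"
    if "x \<in> ?E" "0 < d" for x d
  proof -
    obtain r where r: "r > 0" "ball x r \<subseteq> \<gamma> x"
      using \<gamma> by (meson gauge_def open_contains_ball)
    obtain y where y: "y \<in> {a..b}" "y \<noteq> x" "\<bar>y - x\<bar> < min r d" "?bad x y"
    proof -
      have "min r d > 0" using r \<open>0 < d\<close> by simp
      with \<open>x \<in> ?E\<close> have "\<exists>y\<in>{a..b}. y \<noteq> x \<and> \<bar>y - x\<bar> < min r d \<and> ?bad x y" by blast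
      with that show thesis by blast
    qed
    have "I (x,y) \<subseteq> ball x r" using y by (auto simp: I_def dist_real_def)
    then have "(x,y) \<in> K" using r y that by (auto simp: K_def)
    moreover have "x \<in> I (x,y)" by (auto simp: I_def)
    ultimately show ?thesis using y \<open>0 < d\<close> by (intro exI[of _ "(x,y)"]) (auto simp: I)
  qed
  obtain C where C: "countable C" "C \<subseteq> K"
     "pairwise (\<lambda>i j. disjnt (I i) (I j)) C"
     "negligible (?E - (\<Union>i \<in> C. I i))"
    using Vitali_covering_theorem_cballs[where K=K and S="?E" and a="\<lambda>i. (fst i + snd i)/2"
       and r="\<lambda>i. \<bar>snd i - fst i\<bar>/2", OF v1 v2] by (auto simp: I)
  have Im: "I i \<in> lmeasurable" "measure lebesgue (I i) = \<bar>snd i - fst i\<bar>" for i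
    by (auto simp: I_def split: prod.splits)
  \<comment> \<open>Saks-Henstock handles finite families only; the bound is uniform in them, so it
    passes to the countable union.\<close>
  have bound: "measure lebesgue (\<Union>i\<in>G. I i) \<le> e" if G: "finite G" "G \<subseteq> C" for G
  proof -
    define p where "p = (\<lambda>i. (fst i, I i)) ` G"
    have disj: "I i \<inter> I j = {}" if "i \<in> G" "j \<in> G" "i \<noteq> j" for i j
      using C(3) G(2) that by (auto simp: pairwise_def disjnt_def)
    have ne: "fst i \<in> I i" for i by (auto simp: I_def split: prod.splits)
    have inj: "inj_on (\<lambda>i. (fst i, I i)) G"
      using disj ne by (auto simp: inj_on_def) (metis disjoint_iff fst_conv)
    have GK: "i \<in> K" if "i \<in> G" for i using that G C by auto
    have "p tagged_partial_division_of cbox a b"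
      unfolding tagged_partial_division_of_def p_def
    proof (intro conjI allI impI)
      show "finite ((\<lambda>i. (fst i, I i)) ` G)" using G by simp
    next
      fix x S assume "(x,S) \<in> (\<lambda>i. (fst i, I i)) ` G"
      then obtain i where i: "i \<in> G" "x = fst i" "S = I i" by auto
      show "x \<in> S" using ne i by simp
      show "S \<subseteq> cbox a b" "\<exists>u v. S = cbox u v" using GK[OF i(1)] i
        by (auto simp: I_def K_def)
    next
      fix x1 S1 x2 S2
      assume "(x1, S1) \<in> (\<lambda>i. (fst i, I i)) ` G \<and> (x2, S2) \<in> (\<lambda>i. (fst i, I i)) ` G \<and> (x1, S1) \<noteq> (x2, S2)"
      then obtain i j where "i \<in> G" "j \<in> G" "i \<noteq> j" "S1 = I i" "S2 = I j" by auto
      then show "interior S1 \<inter> interior S2 = {}" using disj[of i j] interior_subset by blast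
    qed
    moreover have "\<gamma> fine p" using GK by (force simp: fine_def p_def K_def)
    ultimately have "sum (\<lambda>(x,k). norm(content k *\<^sub>R f x - integral k f)) p < e * c" by (rule H)
    then have "(\<Sum>i\<in>G. norm (content (I i) *\<^sub>R f (fst i) - integral (I i) f)) < e * c"
      unfolding p_def by (simp add: sum.reindex[OF inj])
    moreover have "c * measure lebesgue (I i) \<le> norm (content (I i) *\<^sub>R f (fst i) - integral (I i) f)"
      if "i \<in> G" for i
    proof -
      obtain x y where i: "i = (x,y)" by (cases i)
      have xy: "x \<in> {a..b}" "y \<in> {a..b}" "?bad x y" using GK[OF that] by (auto simp: K_def i)
      show ?thesis
      proof (cases "x \<le> y")
        case True
        then show ?thesis using indefinite_integral_diff_real[OF f xy(1,2) True] xy(3)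
          by (simp add: i I_def min_def max_def norm_minus_commute)
      next
        case False
        then have "y \<le> x" by simp
        have "norm (- (?F y - ?F x - (y - x) *\<^sub>R f x)) = norm (integral {y..x} f - (x - y) *\<^sub>R f x)"
          unfolding indefinite_integral_diff_real[OF f xy(2,1) \<open>y \<le> x\<close>, symmetric]
          by (simp add: algebra_simps)
        then show ?thesis using xy(3) False
          by (simp add: i I_def min_def max_def norm_minus_commute)
      qed
    qed
    then have "(\<Sum>i\<in>G. c * measure lebesgue (I i)) \<le> (\<Sum>i\<in>G. norm (content (I i) *\<^sub>R f (fst i) - integral (I i) f))"
      by (rule sum_mono)
    ultimately have "c * (\<Sum>i\<in>G. measure lebesgue (I i)) < c * e"
      by (simp add: sum_distrib_left mult.commute)
    then have "(\<Sum>i\<in>G. measure lebesgue (I i)) \<le> e" using c by simp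
    moreover have "measure lebesgue (\<Union>i\<in>G. I i) \<le> (\<Sum>i\<in>G. measure lebesgue (I i))"
      by (rule measure_UNION_le) (use G Im in auto)
    ultimately show ?thesis by simp
  qed
  have UC: "(\<Union>i\<in>C. I i) \<in> lmeasurable" "measure lebesgue (\<Union>i\<in>C. I i) \<le> e"
    using fmeasurable_UN_bound[OF C(1), of I lebesgue e] measure_UN_bound[OF C(1), of I lebesgue e]
      Im bound by auto
  show "\<exists>T. ?E \<subseteq> T \<and> T \<in> lmeasurable \<and> measure lebesgue T \<le> e"
  proof (intro exI conjI)
    let ?T = "(\<Union>i\<in>C. I i) \<union> (?E - (\<Union>i\<in>C. I i))"
    show "?E \<subseteq> ?T" by blast
    show "?T \<in> lmeasurable" using UC negligible_imp_measurable[OF C(4)] by (rule_tac fmeasurable.Un)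
    show "measure lebesgue ?T \<le> e"
      using UC measure_Un_le[of "\<Union>i\<in>C. I i" lebesgue "?E - (\<Union>i\<in>C. I i)"]
        negligible_imp_measurable[OF C(4)] negligible_imp_measure0[OF C(4)]
      by (metis (no_types, lifting) add.right_neutral fmeasurableD order_trans)
  qed
qed

text \<open>The exceptional sets of the preceding lemma for c = 1/(n+1) have a negligible union. Off
  it, the error of the difference quotient is eventually at most every 1/(n+1), which is
  differentiability with derivative \<open>f x\<close>.\<close>

lemma indefinite_integral_has_vector_derivative_ae:
  fixes f :: "real \<Rightarrow> 'b::euclidean_space"
  assumes f: "f integrable_on {a..b}"
  obtains N where "negligible N"
    "\<And>x. x \<in> {a..b} - N \<Longrightarrow> ((\<lambda>u. integral {a..u} f) has_vector_derivative f x) (at x within {a..b})"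
proof -
  let ?F = "\<lambda>x. integral {a..x} f"
  define E where "E c = {x \<in> {a..b}. \<forall>d>0. \<exists>y\<in>{a..b}. y \<noteq> x \<and> \<bar>y - x\<bar> < d \<and>
           norm (?F y - ?F x - (y - x) *\<^sub>R f x) > c * \<bar>y - x\<bar>}" for c
  define N where "N = (\<Union>n::nat. E (1 / (real n + 1)))"
  show thesis
  proof
    show "negligible N" unfolding N_def
    proof (rule negligible_countable_Union)
      fix S assume "S \<in> range (\<lambda>n::nat. E (1 / (real n + 1)))"
      then obtain n :: nat where S: "S = E (1 / (real n + 1))" by blast
      show "negligible S" unfolding S E_def by (rule negligible_bad_difference_quotient[OF f]) simp
    qed simp
  next
    fix x assume x: "x \<in> {a..b} - N"
    show "(?F has_vector_derivative f x) (at x within {a..b})"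
      unfolding has_vector_derivative_def has_derivative_within_alt
    proof (intro conjI allI impI)
      show "bounded_linear (\<lambda>h. h *\<^sub>R f x)" by (rule bounded_linear_scaleR_left)
      fix e :: real assume "e > 0"
      then obtain n :: nat where n: "1 / (real n + 1) < e"
        by (metis Suc_eq_plus1 add.commute of_nat_Suc nat_approx_posE)
      from x have "x \<notin> E (1 / (real n + 1))" by (auto simp: N_def)
      then obtain d where d: "d > 0" "\<And>y. y \<in> {a..b} \<Longrightarrow> y \<noteq> x \<Longrightarrow> \<bar>y - x\<bar> < d \<Longrightarrow>
          norm (?F y - ?F x - (y - x) *\<^sub>R f x) \<le> 1 / (real n + 1) * \<bar>y - x\<bar>"
        using x by (force simp: E_def not_less)
      show "\<exists>d>0. \<forall>y\<in>{a..b}. norm (y - x) < d \<longrightarrow>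
          norm (?F y - ?F x - (y - x) *\<^sub>R f x) \<le> e * norm (y - x)"
      proof (intro exI[of _ d] conjI ballI impI d(1))
        fix y assume y: "y \<in> {a..b}" "norm (y - x) < d"
        have "1 / (real n + 1) * \<bar>y - x\<bar> \<le> e * \<bar>y - x\<bar>" using n by (intro mult_right_mono) auto
        then show "norm (?F y - ?F x - (y - x) *\<^sub>R f x) \<le> e * norm (y - x)"
          using d(2)[of y] y by (cases "y = x") force+
      qed
    qed
  qed
qed

section \<open>Absolutely continuous functions and the fundamental theorem of calculus\<close>

lemma division_content_eq_sum:
  fixes D :: "real set set"
  assumes D: "D division_of \<Union>D"
  shows "(\<Sum>I\<in>D. Sup I - Inf I) = measure lebesgue (\<Union>D)"
proof -
  have "measure lebesgue (\<Union>D) = (\<Sum>I\<in>D. measure lebesgue I)"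
    using content_division[OF D] by simp
  also have "\<dots> = (\<Sum>I\<in>D. Sup I - Inf I)"
  proof (rule sum.cong[OF refl])
    fix I assume I: "I \<in> D"
    then obtain u v where "I = {u..v}" "I \<noteq> {}" using division_ofD(3,4)[OF D I] by auto
    then show "measure lebesgue I = Sup I - Inf I" by auto
  qed
  finally show ?thesis by simp
qed

text \<open>Supplies the gauge at exceptional points: intervals tagged there are confined to
  \<open>T\<close>, so their total length is small.\<close>

lemma negligible_outer_open_real:
  fixes N :: "real set"
  assumes "negligible N" "e > 0"
  obtains T where "open T" "N \<subseteq> T" "T \<in> lmeasurable" "measure lebesgue T < e"
proof -
  have N: "N \<in> null_sets lebesgue" using assms(1) negligible_iff_null_sets by blast
  then obtain T where T: "open T" "N \<subseteq> T" "T - N \<in> lmeasurable" "emeasure lebesgue (T - N) < ennreal e"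
    using sets_lebesgue_outer_open[of N e] assms(2) by (auto dest: null_setsD2)
  have eq: "emeasure lebesgue T = emeasure lebesgue (T - N)"
    using emeasure_Diff_null_set[OF N, of T] T(1) by (simp add: borel_open)
  have m: "T \<in> lmeasurable" using T eq
    by (metis (no_types, lifting) borel_open fmeasurableD2 fmeasurableI infinity_ennreal_def lborelD sets_completionI_sets top.not_eq_extremum)
  have "measure lebesgue T < e"
    using T(4) assms(2) unfolding eq[symmetric] emeasure_eq_measure2[OF m] by (simp add: ennreal_less_iff)
  with T m that show thesis by blast
qed

text \<open>The gauge plays two roles. An interval tagged where the derivative exists is so short
  that the increment of \<open>f\<close> is linear up to \<open>e1\<close> times the length. An
  interval tagged in \<open>N\<close> must lie in an open set of small measure, so absolute
  continuity bounds the sum of all such increments.\<close>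

theorem has_integral_absolutely_continuous:
  fixes f :: "real \<Rightarrow> 'a::banach"
  assumes ab: "a \<le> b" and ac: "absolutely_continuous_on {a..b} f" and N: "negligible N"
    and der: "\<And>x. x \<in> {a..b} - N \<Longrightarrow> (f has_vector_derivative g x) (at x within {a..b})"
  shows "(g has_integral f b - f a) {a..b}"
proof -
  \<comment> \<open>Zero on \<open>N\<close>, so that a tag there contributes nothing but an
    increment of \<open>f\<close>.\<close>
  define h where "h x = (if x \<in> N then 0 else g x)" for x
  have "(h has_integral f b - f a) {a..b}"
    unfolding has_integral_real
  proof (intro allI impI)
    fix e :: real assume e: "e > 0"
    define e1 where "e1 = e / (2 * (b - a + 1))"
    have e1: "e1 > 0" "e1 * (b - a) < e / 2" using ab e by (auto simp: e1_def field_simps)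
    have "e/2 > 0" using e by simp
    note ac[unfolded absolutely_continuous_on_def, rule_format, OF this]
    then obtain \<delta> where \<delta>: "\<delta> > 0" "\<And>D. D division_of \<Union>D \<Longrightarrow> \<Union>D \<subseteq> {a..b} \<Longrightarrow>
        (\<Sum>I\<in>D. Sup I - Inf I) < \<delta> \<Longrightarrow> (\<Sum>I\<in>D. norm (f (Sup I) - f (Inf I))) < e/2"
      by (elim exE conjE) simp
    obtain T where T: "open T" "N \<subseteq> T" "T \<in> lmeasurable" "measure lebesgue T < \<delta>"
      using negligible_outer_open_real[OF N \<delta>(1)] .
    define ok where "ok x d \<longleftrightarrow> d > 0 \<and> (x \<in> {a..b} - N \<longrightarrow>
         (\<forall>y\<in>{a..b}. norm (y-x) < d \<longrightarrow> norm (f y - f x - (y-x) *\<^sub>R g x) \<le> e1 * norm (y-x)))" for x d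
    have "\<exists>d. ok x d" for x
    proof (cases "x \<in> {a..b} - N")
      case True
      have "\<forall>e>0. \<exists>d>0. \<forall>y\<in>{a..b}. norm (y-x) < d \<longrightarrow> norm (f y - f x - (y-x) *\<^sub>R g x) \<le> e * norm (y-x)"
        using der[OF True] unfolding has_vector_derivative_def has_derivative_within_alt by (rule conjunct2)
      with e1(1) show ?thesis unfolding ok_def by blast
    next
      case False
      then have "ok x 1" unfolding ok_def by (blast intro: zero_less_one)
      then show ?thesis by (rule exI)
    qed
    then have "\<forall>x. \<exists>d. ok x d" by (rule allI)
    from choice[OF this] obtain d where okd: "\<forall>x. ok x (d x)" by (rule exE)
    have d1: "0 < d x" for x using okd[rule_format, of x] unfolding ok_def by (rule conjunct1)
    have d2: "norm (f y - f x - (y-x) *\<^sub>R g x) \<le> e1 * norm (y-x)"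
      if "x \<in> {a..b} - N" "y \<in> {a..b}" "norm (y-x) < d x" for x y
      using conjunct2[OF okd[rule_format, of x, unfolded ok_def]] that by blast
    define \<gamma> where "\<gamma> x = (if x \<in> N then T else ball x (d x))" for x
    have g: "gauge \<gamma>" using T d1 by (auto simp: gauge_def \<gamma>_def)
    show "\<exists>\<gamma>. gauge \<gamma> \<and> (\<forall>\<D>. \<D> tagged_division_of {a..b} \<and> \<gamma> fine \<D> \<longrightarrow>
        norm (sum (\<lambda>(x,k). content(k) *\<^sub>R h x) \<D> - (f b - f a)) < e)"
    proof (intro exI[of _ \<gamma>] conjI g allI impI, elim conjE)
      fix p assume p: "p tagged_division_of {a..b}" and fine: "\<gamma> fine p"
      have fin: "finite p" using p by blast
      let ?t = "\<lambda>(x::real,K). content K *\<^sub>R h x - (f (Sup K) - f (Inf K))"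
      define p1 where "p1 = {i \<in> p. fst i \<in> N}"
      define p2 where "p2 = {i \<in> p. fst i \<notin> N}"
      have ppart: "p = p1 \<union> p2" "p1 \<inter> p2 = {}" "finite p1" "finite p2"
        using fin by (auto simp: p1_def p2_def)
      have K: "\<exists>u v. K = {u..v} \<and> u \<le> v \<and> x \<in> {u..v} \<and> u \<in> {a..b} \<and> v \<in> {a..b}" if xKp: "(x,K) \<in> p" for x K
    proof -
      obtain u v where "K = cbox u v" using tagged_division_ofD(4)[OF p xKp] by blast
      then show ?thesis using tagged_division_ofD(2,3)[OF p xKp] by (intro exI[of _ u] exI[of _ v]) auto
    qed
      have "(\<Sum>(x,K)\<in>p. content K *\<^sub>R h x) - (f b - f a) = sum ?t p"
        using additive_tagged_division_1[OF ab p, of f] by (simp add: case_prod_unfold sum_subtractf)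
      also have "sum ?t p = sum ?t p1 + sum ?t p2"
        by (subst ppart(1), rule sum.union_disjoint[OF ppart(3,4,2)])
      finally have eq: "(\<Sum>(x,K)\<in>p. content K *\<^sub>R h x) - (f b - f a) = sum ?t p1 + sum ?t p2" .
      have "norm (sum ?t p2) \<le> (\<Sum>(x,K)\<in>p2. e1 * (Sup K - Inf K))"
      proof (rule sum_norm_le, clarify)
        fix x K assume xK: "(x,K) \<in> p2"
        then have xp: "(x,K) \<in> p" "x \<notin> N" by (auto simp: p2_def)
        then obtain u v where uv: "K = {u..v}" "u \<le> v" "x \<in> {u..v}" "u \<in> {a..b}" "v \<in> {a..b}" using K by blast
        have "K \<subseteq> \<gamma> x" using fine xp(1) by (rule fineD)
        moreover have "u \<in> K" "v \<in> K" using uv by simp_all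
        ultimately have "u \<in> ball x (d x)" "v \<in> ball x (d x)" using xp(2) unfolding \<gamma>_def by auto
        then have b: "norm (u - x) < d x" "norm (v - x) < d x"
          by (simp_all add: dist_real_def abs_minus_commute)
        \<comment> \<open>The tag lies between u and v, so the errors towards the two ends add up to
          \<open>e1 * (v - u)\<close>.\<close>
        have "norm ((v - u) *\<^sub>R g x - (f v - f u))
            = norm ((f u - f x - (u - x) *\<^sub>R g x) - (f v - f x - (v - x) *\<^sub>R g x))"
          by (simp add: algebra_simps)
        also have "\<dots> \<le> norm (f u - f x - (u - x) *\<^sub>R g x) + norm (f v - f x - (v - x) *\<^sub>R g x)"
          by (rule norm_triangle_ineq4)
        also have "\<dots> \<le> e1 * norm (u - x) + e1 * norm (v - x)"
          by (intro add_mono d2 b uv) (use uv xp in auto)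
        also have "\<dots> = e1 * (v - u)" using uv by (simp add: algebra_simps)
        finally show "norm (content K *\<^sub>R h x - (f (Sup K) - f (Inf K))) \<le> e1 * (Sup K - Inf K)"
          using uv xp by (simp add: h_def)
      qed
      also have "\<dots> \<le> (\<Sum>(x,K)\<in>p. e1 * (Sup K - Inf K))"
      proof (rule sum_mono2[OF fin])
        show "p2 \<subseteq> p" using ppart by blast
        fix i assume "i \<in> p - p2"
        then obtain x K where "i = (x,K)" "(x,K) \<in> p" by (cases i) auto
        with K[of x K] e1(1) show "0 \<le> (case i of (x, K) \<Rightarrow> e1 * (Sup K - Inf K))" by auto
      qed
      also have "\<dots> = e1 * (b - a)"
        using additive_tagged_division_1[OF ab p, of "\<lambda>x. x"]
        by (simp add: sum_distrib_left[symmetric] case_prod_unfold)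
      also have "\<dots> < e / 2" by (rule e1)
      finally have n2: "norm (sum ?t p2) < e / 2" .
      have "norm (sum ?t p1) \<le> (\<Sum>i\<in>p1. norm (f (Sup (snd i)) - f (Inf (snd i))))"
        by (rule sum_norm_le) (auto simp: p1_def h_def norm_minus_commute)
      also have "\<dots> < e / 2"
      proof -
        have pp: "p1 tagged_partial_division_of {a..b}"
          using p by (auto simp: p1_def tagged_division_of_def intro: tagged_partial_division_subset)
        have dv: "snd ` p1 division_of \<Union>(snd ` p1)" by (rule partial_division_of_tagged_division[OF pp])
        \<comment> \<open>Absolute continuity sums over intervals, not over tagged ones, so no
          interval may be counted twice. One with two tags has empty interior, hence is a single
          point, and the tags coincide.\<close>
        have inj: "inj_on snd p1"
        proof (rule inj_onI, clarsimp)
          fix x K x' assume *: "(x,K) \<in> p1" "(x',K) \<in> p1"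
          show "x = x'"
          proof (rule ccontr)
            assume "x \<noteq> x'"
            then have "interior K = {}" using tagged_partial_division_ofD(5)[OF pp *] by auto
            moreover obtain u v where "K = {u..v}" "x \<in> {u..v}" using K[of x K] * by (auto simp: p1_def)
            moreover have "x' \<in> K" using tagged_partial_division_ofD(2)[OF pp *(2)] .
            ultimately show False using \<open>x \<noteq> x'\<close> by auto
          qed
        qed
        have "K \<subseteq> T" if "(x,K) \<in> p1" for x K
          using fineD[OF fine, of x K] that by (simp add: p1_def \<gamma>_def)
        then have "K \<subseteq> T" if "K \<in> snd ` p1" for K using that by force
        then have sT: "\<Union>(snd ` p1) \<subseteq> T" by blast
        have "(\<Sum>I\<in>snd ` p1. Sup I - Inf I) = measure lebesgue (\<Union>(snd ` p1))"
          by (rule division_content_eq_sum[OF dv])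
        also have "\<dots> \<le> measure lebesgue T"
          by (rule measure_mono_fmeasurable[OF sT fmeasurableD[OF lmeasurable_division[OF dv]] T(3)])
        also have "\<dots> < \<delta>" by (rule T(4))
        finally have small: "(\<Sum>I\<in>snd ` p1. Sup I - Inf I) < \<delta>" .
        have "K \<subseteq> {a..b}" if "K \<in> snd ` p1" for K
          using that tagged_partial_division_ofD(3)[OF pp] by force
        then have "\<Union>(snd ` p1) \<subseteq> {a..b}" by blast
        from \<delta>(2)[OF dv this small] show ?thesis
          unfolding sum.reindex[OF inj] o_def .
      qed
      finally have n1: "norm (sum ?t p1) < e / 2" .
      have "norm (sum ?t p1 + sum ?t p2) < e" using n1 n2 norm_triangle_ineq[of "sum ?t p1" "sum ?t p2"] by linarith
      then show "norm (sum (\<lambda>(x,k). content(k) *\<^sub>R h x) p - (f b - f a)) < e" unfolding eq .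
    qed
  qed
  then show ?thesis
  proof (rule has_integral_spike[OF N, rotated])
    show "g x = h x" if "x \<in> {a..b} - N" for x using that by (simp add: h_def)
  qed
qed

text \<open>Splits \<open>g\<close> into a bounded part and a nonnegative remainder of small
  integral. The truncations converge to \<open>g\<close> pointwise, dominated by \<open>g\<close>
  itself.\<close>

lemma integral_truncation_small:
  fixes g :: "real \<Rightarrow> real"
  assumes g: "g integrable_on {a..b}" and pos: "\<And>x. x \<in> {a..b} \<Longrightarrow> 0 \<le> g x" and e: "e > 0"
  obtains n :: nat where "(\<lambda>x. min (g x) (real n)) integrable_on {a..b}"
    "integral {a..b} g - integral {a..b} (\<lambda>x. min (g x) (real n)) < e"
proof -
  have int: "(\<lambda>x. min (g x) (real n)) integrable_on {a..b}" for n :: nat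
  proof -
    have "g absolutely_integrable_on {a..b}" "(\<lambda>x. real n) absolutely_integrable_on {a..b}"
      using g pos by (auto intro: nonnegative_absolutely_integrable_1)
    from absolutely_integrable_min[OF this]
    have "(\<lambda>x. min (g x) (real n)) absolutely_integrable_on {a..b}" by simp
    then show ?thesis by (rule set_lebesgue_integral_eq_integral(1))
  qed
  have "(\<lambda>n. integral {a..b} (\<lambda>x. min (g x) (real n))) \<longlonglongrightarrow> integral {a..b} g"
  proof (rule dominated_convergence(2)[OF int g])
    fix x n assume "x \<in> {a..b}" then show "norm (min (g x) (real n)) \<le> g x" using pos[of x] by auto
  next
    fix x
    have "\<forall>\<^sub>F n in sequentially. min (g x) (real n) = g x"
      using eventually_ge_at_top[of "nat \<lceil>g x\<rceil>"] by eventually_elim (simp add: min_absorb1 nat_ceiling_le_eq)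
    then show "(\<lambda>n. min (g x) (real n)) \<longlonglongrightarrow> g x" by (rule tendsto_eventually)
  qed
  from LIMSEQ_D[OF this e] obtain n where
    "norm (integral {a..b} (\<lambda>x. min (g x) (real n)) - integral {a..b} g) < e" by blast
  with int show thesis by (intro that[of n]) (auto simp: abs_less_iff)
qed

text \<open>Intervals of total length below \<open>\<delta>\<close> pick up at most
  \<open>real n * \<delta>\<close> from the truncated norm and less than e/2 from the remainder,
  wherever they are placed.\<close>

lemma absolutely_continuous_on_indefinite_integral:
  fixes f :: "real \<Rightarrow> 'b::euclidean_space"
  assumes f: "f absolutely_integrable_on {a..b}"
  shows "absolutely_continuous_on {a..b} (\<lambda>x. integral {a..x} f)"
  unfolding absolutely_continuous_on_def
proof (intro allI impI)
  let ?g = "\<lambda>x. norm (f x)"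
  have fi: "f integrable_on {a..b}" and gi: "?g integrable_on {a..b}"
    using f by (auto simp: absolutely_integrable_on_def)
  fix e :: real assume e: "e > 0"
  then have "e / 2 > 0" by simp
  from integral_truncation_small[OF gi _ this] obtain n where
    n: "(\<lambda>x. min (?g x) (real n)) integrable_on {a..b}"
    "integral {a..b} ?g - integral {a..b} (\<lambda>x. min (?g x) (real n)) < e/2" by auto
  define m where "m x = min (?g x) (real n)" for x
  have m: "m integrable_on {a..b}" "integral {a..b} ?g - integral {a..b} m < e/2"
    using n unfolding m_def by simp_all
  define \<delta> where "\<delta> = e / (2 * (real n + 1))"
  have \<delta>: "\<delta> > 0" "real n * \<delta> \<le> e / 2" using e by (auto simp: \<delta>_def field_simps)
  show "\<exists>\<delta>>0. \<forall>D. D division_of \<Union>D \<and> \<Union>D \<subseteq> {a..b} \<and> (\<Sum>I\<in>D. Sup I - Inf I) < \<delta> \<longrightarrow>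
        (\<Sum>I\<in>D. norm (integral {a..Sup I} f - integral {a..Inf I} f)) < e"
  proof (intro exI[of _ \<delta>] conjI \<delta> allI impI, elim conjE)
    fix D :: "real set set"
    assume D: "D division_of \<Union>D" and sub: "\<Union>D \<subseteq> {a..b}" and len: "(\<Sum>I\<in>D. Sup I - Inf I) < \<delta>"
    have D_I: "\<exists>u v. I = {u..v} \<and> u \<le> v \<and> u \<in> {a..b} \<and> v \<in> {a..b}" if I: "I \<in> D" for I
    proof -
      obtain u v where uv: "I = {u..v}" using division_ofD(4)[OF D I] by auto
      moreover have "I \<noteq> {}" using division_ofD(3)[OF D I] .
      moreover have "I \<subseteq> {a..b}" using I sub by blast
      ultimately show ?thesis by (intro exI[of _ u] exI[of _ v]) auto
    qed
    have sI: "I \<subseteq> {a..b}" if "I \<in> D" for I using that sub by blast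
    have on: "h integrable_on I" if "h integrable_on {a..b}" "I \<in> D" for h :: "real \<Rightarrow> real" and I
      using D_I[OF that(2)] sI[OF that(2)] integrable_on_subinterval[OF that(1)] by auto
    have "norm (integral {a..Sup I} f - integral {a..Inf I} f) \<le>
        integral I (\<lambda>x. ?g x - m x) + real n * (Sup I - Inf I)" if I: "I \<in> D" for I
    proof -
      obtain u v where uv: "I = {u..v}" "u \<le> v" "u \<in> {a..b}" "v \<in> {a..b}" using D_I[OF I] by blast
      have "norm (integral {a..v} f - integral {a..u} f) = norm (integral {u..v} f)"
        using indefinite_integral_diff_real[OF fi uv(3,4,2)] by simp
      also have "\<dots> \<le> integral {u..v} ?g"
        by (rule Henstock_Kurzweil_Integration.integral_norm_bound_integral)
          (use uv fi gi in \<open>auto intro: integrable_on_subinterval\<close>)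
      also have "\<dots> = integral {u..v} (\<lambda>x. ?g x - m x) + integral {u..v} m"
        using on[OF gi I] on[OF m(1) I] uv by (subst Henstock_Kurzweil_Integration.integral_diff) auto
      also have "integral {u..v} m \<le> integral {u..v} (\<lambda>x. real n)"
        by (rule integral_le) (use on[OF m(1) I] uv in \<open>auto simp: m_def\<close>)
      finally show ?thesis using uv by (simp add: mult.commute)
    qed
    then have "(\<Sum>I\<in>D. norm (integral {a..Sup I} f - integral {a..Inf I} f))
        \<le> (\<Sum>I\<in>D. integral I (\<lambda>x. ?g x - m x) + real n * (Sup I - Inf I))" by (rule sum_mono)
    also have "\<dots> = (\<Sum>I\<in>D. integral I (\<lambda>x. ?g x - m x)) + real n * (\<Sum>I\<in>D. Sup I - Inf I)"
      by (simp add: sum.distrib sum_distrib_left)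
    also have "(\<Sum>I\<in>D. integral I (\<lambda>x. ?g x - m x)) = integral (\<Union>D) (\<lambda>x. ?g x - m x)"
      using on[OF integrable_diff[OF gi m(1)]]
      by (rule integral_combine_division_bottomup[OF D, symmetric])
    also have "integral (\<Union>D) (\<lambda>x. ?g x - m x) \<le> integral {a..b} (\<lambda>x. ?g x - m x)"
    proof (rule integral_subset_le[OF sub])
      show "(\<lambda>x. ?g x - m x) integrable_on \<Union>D"
        using on[OF integrable_diff[OF gi m(1)]] integrable_combine_division[OF D] by blast
      show "(\<lambda>x. ?g x - m x) integrable_on {a..b}" using gi m(1) by (rule integrable_diff)
    qed (auto simp: m_def)
    also have "\<dots> = integral {a..b} ?g - integral {a..b} m"
      using gi m(1) by (rule Henstock_Kurzweil_Integration.integral_diff)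
    finally have "(\<Sum>I\<in>D. norm (integral {a..Sup I} f - integral {a..Inf I} f))
       \<le> integral {a..b} ?g - integral {a..b} m + real n * (\<Sum>I\<in>D. Sup I - Inf I)" by simp
    moreover have "real n * (\<Sum>I\<in>D. Sup I - Inf I) \<le> real n * \<delta>" using len by (intro mult_left_mono) auto
    ultimately show "(\<Sum>I\<in>D. norm (integral {a..Sup I} f - integral {a..Inf I} f)) < e"
      using m(2) \<delta>(2) by linarith
  qed
qed

lemma absolutely_continuous_on_lipschitz:
  assumes g: "absolutely_continuous_on S g" and K: "K > 0"
    and le: "\<And>u v. u \<in> S \<Longrightarrow> v \<in> S \<Longrightarrow> norm (f u - f v) \<le> K * norm (g u - g v)"
  shows "absolutely_continuous_on S f"
  unfolding absolutely_continuous_on_def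
proof (intro allI impI)
  fix e :: real assume e: "e > 0"
  then have "e / K > 0" using K by simp
  note g[unfolded absolutely_continuous_on_def, rule_format, OF this]
  then obtain \<delta> where \<delta>: "\<delta> > 0" "\<And>D. D division_of \<Union>D \<Longrightarrow> \<Union>D \<subseteq> S \<Longrightarrow>
        (\<Sum>I\<in>D. Sup I - Inf I) < \<delta> \<Longrightarrow> (\<Sum>I\<in>D. norm (g (Sup I) - g (Inf I))) < e / K"
    by (elim exE conjE) simp
  show "\<exists>\<delta>>0. \<forall>D. D division_of \<Union>D \<and> \<Union>D \<subseteq> S \<and> (\<Sum>I\<in>D. Sup I - Inf I) < \<delta> \<longrightarrow>
        (\<Sum>I\<in>D. norm (f (Sup I) - f (Inf I))) < e"
  proof (intro exI[of _ \<delta>] conjI \<delta>(1) allI impI, elim conjE)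
    fix D :: "real set set"
    assume D: "D division_of \<Union>D" and sub: "\<Union>D \<subseteq> S" and len: "(\<Sum>I\<in>D. Sup I - Inf I) < \<delta>"
    have "(\<Sum>I\<in>D. norm (f (Sup I) - f (Inf I))) \<le> (\<Sum>I\<in>D. K * norm (g (Sup I) - g (Inf I)))"
    proof (rule sum_mono)
      fix I assume I: "I \<in> D"
      obtain u v where uv: "I = {u..v}" using division_ofD(4)[OF D I] by auto
      moreover have "I \<noteq> {}" using division_ofD(3)[OF D I] .
      ultimately have "u \<in> I" "v \<in> I" "Sup I = v" "Inf I = u" by auto
      then show "norm (f (Sup I) - f (Inf I)) \<le> K * norm (g (Sup I) - g (Inf I))"
        using le[of v u] I sub by auto
    qed
    also have "\<dots> < e" using \<delta>(2)[OF D sub len] K by (simp add: sum_distrib_left[symmetric] field_simps)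
    finally show "(\<Sum>I\<in>D. norm (f (Sup I) - f (Inf I))) < e" .
  qed
qed

lemma absolutely_continuous_on_imp_continuous_on:
  fixes f :: "real \<Rightarrow> 'a::real_normed_vector"
  assumes "absolutely_continuous_on {a..b} f"
  shows "continuous_on {a..b} f"
  unfolding continuous_on_iff
proof (intro ballI allI impI)
  fix x e :: real assume x: "x \<in> {a..b}" and "e > 0"
  note assms[unfolded absolutely_continuous_on_def, rule_format, OF \<open>e > 0\<close>]
  then obtain \<delta> where \<delta>: "\<delta> > 0" "\<And>D. D division_of \<Union>D \<Longrightarrow> \<Union>D \<subseteq> {a..b} \<Longrightarrow>
        (\<Sum>I\<in>D. Sup I - Inf I) < \<delta> \<Longrightarrow> (\<Sum>I\<in>D. norm (f (Sup I) - f (Inf I))) < e"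
    by (elim exE conjE) simp
  show "\<exists>d>0. \<forall>x'\<in>{a..b}. dist x' x < d \<longrightarrow> dist (f x') (f x) < e"
  proof (intro exI[of _ \<delta>] conjI \<delta>(1) ballI impI)
    fix y assume y: "y \<in> {a..b}" "dist y x < \<delta>"
    let ?I = "{min x y..max x y}"
    have "{?I} division_of \<Union>{?I}" by (rule division_ofI) (auto intro: exI[of _ "min x y"])
    moreover have "\<Union>{?I} \<subseteq> {a..b}" using x y by auto
    moreover have "(\<Sum>I\<in>{?I}. Sup I - Inf I) < \<delta>" using y by (auto simp: dist_real_def min_def max_def)
    ultimately have "(\<Sum>I\<in>{?I}. norm (f (Sup I) - f (Inf I))) < e" by (rule \<delta>(2))
    then show "dist (f y) (f x) < e"
      by (auto simp: dist_norm min_def max_def norm_minus_commute split: if_splits)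
  qed
qed

section \<open>Gronwall's inequality with a summable coefficient\<close>

lemma abs_power_diff_le:
  fixes u v B :: real
  assumes "0 \<le> u" "u \<le> B" "0 \<le> v" "v \<le> B"
  shows "\<bar>u ^ Suc n - v ^ Suc n\<bar> \<le> (real n + 1) * B ^ n * \<bar>u - v\<bar>"
proof (induction n)
  case (Suc n)
  have B: "0 \<le> B" using assms by simp
  have "u ^ Suc (Suc n) - v ^ Suc (Suc n) = u * (u ^ Suc n - v ^ Suc n) + (u - v) * v ^ Suc n"
    by (simp add: algebra_simps)
  then have "\<bar>u ^ Suc (Suc n) - v ^ Suc (Suc n)\<bar> \<le> u * \<bar>u ^ Suc n - v ^ Suc n\<bar> + \<bar>u - v\<bar> * v ^ Suc n"
    using assms by (metis abs_mult abs_of_nonneg abs_triangle_ineq zero_le_power)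
  also have "\<dots> \<le> B * ((real n + 1) * B ^ n * \<bar>u - v\<bar>) + \<bar>u - v\<bar> * B ^ Suc n"
    using assms Suc B by (intro add_mono mult_mono power_mono) auto
  also have "\<dots> = (real (Suc n) + 1) * B ^ Suc n * \<bar>u - v\<bar>" by (simp add: algebra_simps)
  finally show ?case .
qed simp

text \<open>Generates the terms of the exponential series. The indefinite integral is only
  absolutely continuous, so the chain rule holds almost everywhere; its powers stay absolutely
  continuous because taking powers is Lipschitz on a bounded range, and the fundamental theorem
  applies.\<close>

lemma integral_power_indefinite_integral:
  fixes b :: "real \<Rightarrow> real"
  assumes b: "b integrable_on {a..c}" and pos: "\<And>x. x \<in> {a..c} \<Longrightarrow> 0 \<le> b x" and x: "x \<in> {a..c}"
  shows "((\<lambda>t. b t * ((integral {a..t} b) ^ k / fact k)) has_integral (integral {a..x} b) ^ Suc k / fact (Suc k)) {a..x}"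
proof -
  let ?g = "\<lambda>t. integral {a..t} b"
  have bx: "b integrable_on {a..x}" using b x by (auto intro: integrable_on_subinterval)
  have babs: "b absolutely_integrable_on {a..x}"
    using bx pos x by (intro nonnegative_absolutely_integrable_1) auto
  have on: "b integrable_on {a..t}" if "t \<in> {a..x}" for t
    using that by (intro integrable_on_subinterval[OF bx]) auto
  have g0: "0 \<le> ?g t" if "t \<in> {a..x}" for t
    using on[OF that] pos x that by (intro integral_nonneg) auto
  have gx: "?g t \<le> ?g x" if "t \<in> {a..x}" for t
    using pos x that bx on[OF that] by (intro integral_subset_le) auto
  obtain N where N: "negligible N"
    "\<And>t. t \<in> {a..x} - N \<Longrightarrow> (?g has_vector_derivative b t) (at t within {a..x})"
    using indefinite_integral_has_vector_derivative_ae[OF bx] by blast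
  let ?f = "\<lambda>t. ?g t ^ Suc k / fact (Suc k)"
  have "((\<lambda>t. b t * (?g t ^ k / fact k)) has_integral ?f x - ?f a) {a..x}"
  proof (rule has_integral_absolutely_continuous[OF _ _ N(1)])
    show "a \<le> x" using x by simp
    show "absolutely_continuous_on {a..x} ?f"
    proof (rule absolutely_continuous_on_lipschitz[OF absolutely_continuous_on_indefinite_integral[OF babs]])
      let ?K = "(real k + 1) * ?g x ^ k + 1"
      show "0 < ?K" using g0[of x] x by (auto intro!: add_nonneg_pos mult_nonneg_nonneg)
      fix u v assume uv: "u \<in> {a..x}" "v \<in> {a..x}"
      have "\<bar>?f u - ?f v\<bar> = \<bar>?g u ^ Suc k - ?g v ^ Suc k\<bar> / fact (Suc k)"
        by (simp add: diff_divide_distrib[symmetric] del: fact_Suc power_Suc)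
      also have "\<dots> \<le> \<bar>?g u ^ Suc k - ?g v ^ Suc k\<bar> / 1"
        by (intro divide_left_mono) (auto simp del: fact_Suc power_Suc)
      also have "\<dots> \<le> (real k + 1) * ?g x ^ k * \<bar>?g u - ?g v\<bar>"
        using abs_power_diff_le[of "?g u" "?g x" "?g v" k] g0 gx uv by simp
      also have "\<dots> \<le> ?K * \<bar>?g u - ?g v\<bar>" by (intro mult_right_mono) auto
      finally show "norm (?f u - ?f v) \<le> ?K * norm (?g u - ?g v)" by simp
    qed
    fix t assume "t \<in> {a..x} - N"
    then have "(?g has_real_derivative b t) (at t within {a..x})"
      using N(2) by (simp add: has_real_derivative_iff_has_vector_derivative)
    then have "(?f has_real_derivative (real (Suc k) * ?g t ^ k * b t) / fact (Suc k)) (at t within {a..x})"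
      by (auto intro!: derivative_eq_intros simp del: fact_Suc power_Suc)
    moreover have "(real (Suc k) * ?g t ^ k * b t) / fact (Suc k) = b t * (?g t ^ k / fact k)"
      unfolding fact_Suc by (simp del: of_nat_Suc)
    ultimately show "(?f has_vector_derivative b t * (?g t ^ k / fact k)) (at t within {a..x})"
      by (simp only: has_real_derivative_iff_has_vector_derivative)
  qed
  then show ?thesis by simp
qed

lemma absolutely_integrable_continuous_mult:
  fixes b :: "real \<Rightarrow> real"
  assumes "b absolutely_integrable_on {a..c}" "continuous_on {a..c} \<phi>"
  shows "(\<lambda>t. b t * \<phi> t) absolutely_integrable_on {a..c}"
proof -
  have "(\<lambda>t. \<phi> t * b t) absolutely_integrable_on {a..c}"
    using assms by (intro absolutely_integrable_bounded_measurable_product_real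
      continuous_imp_measurable_on_sets_lebesgue compact_imp_bounded compact_continuous_image) auto
  then show ?thesis by (simp add: mult.commute)
qed

text \<open>The inequality is iterated, not differentiated, since \<open>\<phi>\<close> is only
  continuous. After n rounds the bound is \<open>C\<close> times a partial sum of the exponential
  series plus \<open>S\<close> times its n-th term, where \<open>S\<close> is an upper bound of
  \<open>\<phi>\<close>; the last term tends to zero.\<close>

lemma gronwall:
  fixes b \<phi> :: "real \<Rightarrow> real"
  assumes b: "b integrable_on {a..c}" and pos: "\<And>x. x \<in> {a..c} \<Longrightarrow> 0 \<le> b x"
    and cont: "continuous_on {a..c} \<phi>"
    and le: "\<And>x. x \<in> {a..c} \<Longrightarrow> \<phi> x \<le> C + integral {a..x} (\<lambda>t. b t * \<phi> t)"
    and x: "x \<in> {a..c}"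
  shows "\<phi> x \<le> C * exp (integral {a..x} b)"
proof -
  let ?g = "\<lambda>t. integral {a..t} b"
  have "compact (\<phi> ` {a..c})" using cont by (intro compact_continuous_image) auto
  then have "bounded (\<phi> ` {a..c})" by (rule compact_imp_bounded)
  then obtain S where S: "\<And>x. x \<in> {a..c} \<Longrightarrow> \<phi> x \<le> S"
    unfolding bounded_iff by (metis abs_le_D1 image_eqI real_norm_def)
  have babs: "b absolutely_integrable_on {a..c}" using b pos by (rule nonnegative_absolutely_integrable_1)
  have bphi: "(\<lambda>t. b t * \<phi> t) integrable_on {a..c}"
    using absolutely_integrable_continuous_mult[OF babs cont] by (rule set_lebesgue_integral_eq_integral(1))
  have it: "\<phi> x \<le> C * (\<Sum>i<n. ?g x ^ i / fact i) + S * (?g x ^ n / fact n)" if "x \<in> {a..c}" for n x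
    using that
  proof (induction n arbitrary: x)
    case 0 then show ?case using S by simp
  next
    case (Suc n)
    let ?r = "\<lambda>t. b t * (C * (\<Sum>i<n. ?g t ^ i / fact i) + S * (?g t ^ n / fact n))"
    have req: "?r = (\<lambda>t. (\<Sum>i<n. C * (b t * (?g t ^ i / fact i))) + S * (b t * (?g t ^ n / fact n)))"
      by (rule ext) (simp add: distrib_left sum_distrib_left mult_ac)
    have hr: "(?r has_integral (\<Sum>i<n. C * (?g x ^ Suc i / fact (Suc i))) + S * (?g x ^ Suc n / fact (Suc n))) {a..x}"
      unfolding req
      by (intro has_integral_add has_integral_sum has_integral_mult_right
          integral_power_indefinite_integral[OF b pos Suc.prems]) auto
    have "\<phi> x \<le> C + integral {a..x} (\<lambda>t. b t * \<phi> t)" by (rule le[OF Suc.prems])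
    also have "integral {a..x} (\<lambda>t. b t * \<phi> t) \<le> integral {a..x} ?r"
    proof (rule integral_le)
      show "(\<lambda>t. b t * \<phi> t) integrable_on {a..x}"
        using Suc.prems by (intro integrable_on_subinterval[OF bphi]) auto
      show "?r integrable_on {a..x}" using hr by (rule has_integral_integrable)
      fix t assume "t \<in> {a..x}"
      then have "t \<in> {a..c}" using Suc.prems by simp
      then show "b t * \<phi> t \<le> ?r t" using Suc.IH pos by (intro mult_left_mono) auto
    qed
    also have "integral {a..x} ?r = (\<Sum>i<n. C * (?g x ^ Suc i / fact (Suc i))) + S * (?g x ^ Suc n / fact (Suc n))"
      using hr by (rule integral_unique)
    also have "C + \<dots> = C * (\<Sum>i<Suc n. ?g x ^ i / fact i) + S * (?g x ^ Suc n / fact (Suc n))"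
      unfolding sum.lessThan_Suc_shift by (simp add: distrib_left sum_distrib_left del: fact_Suc power_Suc)
    finally show ?case by simp
  qed
  have e: "(\<lambda>n. ?g x ^ n / fact n) sums exp (?g x)"
    using exp_converges[of "?g x"] by (simp add: divide_inverse mult.commute)
  have "(\<lambda>n. C * (\<Sum>i<n. ?g x ^ i / fact i) + S * (?g x ^ n / fact n)) \<longlonglongrightarrow> C * exp (?g x) + S * 0"
    using e unfolding sums_def
    by (intro tendsto_intros) (use sums_summable[OF e] in \<open>auto dest: summable_LIMSEQ_zero\<close>)
  then have "\<phi> x \<le> C * exp (?g x) + S * 0"
    by (rule LIMSEQ_le_const) (use it x in blast)
  then show ?thesis by simp
qed

section \<open>Linear Caratheodory equations\<close>

lemma absolutely_integrable_bilinear_continuous: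
  fixes h :: "'a::euclidean_space \<Rightarrow> 'b::euclidean_space \<Rightarrow> 'c::euclidean_space"
  assumes h: "bounded_bilinear h" and A: "A absolutely_integrable_on {a..c::real}"
    and Y: "continuous_on {a..c} Y"
  shows "(\<lambda>t. h (A t) (Y t)) absolutely_integrable_on {a..c}"
proof -
  have "bilinear (\<lambda>y x. h x y)"
    unfolding bilinear_conv_bounded_bilinear by (rule bounded_bilinear.flip[OF h])
  then show ?thesis
    by (rule absolutely_integrable_bounded_measurable_product)
      (use A Y in \<open>auto intro!: continuous_imp_measurable_on_sets_lebesgue compact_imp_bounded
        compact_continuous_image\<close>)
qed

text \<open>The integral form is the one to which Picard iteration and Gronwall's inequality apply
  directly. If \<open>A\<close> is absolutely integrable, continuity of \<open>Y\<close> makes the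
  integrand so too. Canonical systems use matrix multiplication for \<open>h\<close>.\<close>

definition linear_ode_solution ::
  "('a \<Rightarrow> 'b \<Rightarrow> 'b) \<Rightarrow> (real \<Rightarrow> 'a) \<Rightarrow> real \<Rightarrow> real \<Rightarrow> 'b \<Rightarrow> (real \<Rightarrow> 'b::euclidean_space) \<Rightarrow> bool" where
  "linear_ode_solution h A a c y Y \<longleftrightarrow> continuous_on {a..c} Y \<and>
     (\<forall>x\<in>{a..c}. Y x = y + integral {a..x} (\<lambda>t. h (A t) (Y t)))"

text \<open>Neumann series: the n-th iterated integral is bounded by norm y times g^n / n!, where g
  is the indefinite integral of \<open>K * norm (A t)\<close>, so the series converges
  uniformly.\<close>

lemma linear_ode_solution_exists:
  fixes h :: "'a::euclidean_space \<Rightarrow> 'b::euclidean_space \<Rightarrow> 'b"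
  assumes h: "bounded_bilinear h" and A: "A absolutely_integrable_on {a..c}"
  shows "\<exists>Y. linear_ode_solution h A a c y Y"
proof -
  obtain K where K: "K > 0" "\<And>x y. norm (h x y) \<le> norm x * norm y * K"
    using bounded_bilinear.pos_bounded[OF h] by blast
  define b where "b t = K * norm (A t)" for t
  have bint: "b integrable_on {a..c}" and bpos: "\<And>t. 0 \<le> b t"
    using A K unfolding b_def[abs_def] absolutely_integrable_on_def by (auto intro!: integrable_on_mult_right)
  let ?g = "\<lambda>x. integral {a..x} b"
  \<comment> \<open>\<open>T n\<close> is the n-th term of the series, not the n-th Picard iterate;
    the iterates are the partial sums.\<close>
  define T where "T = rec_nat (\<lambda>x. y) (\<lambda>n Y x. integral {a..x} (\<lambda>t. h (A t) (Y t)))"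
  have T0: "T 0 x = y" and TS: "T (Suc n) x = integral {a..x} (\<lambda>t. h (A t) (T n t))" for n x
    by (simp_all add: T_def)
  have Tc: "continuous_on {a..c} (T n)" for n
  proof (induction n)
    case (Suc n)
    have "(\<lambda>t. h (A t) (T n t)) integrable_on {a..c}"
      using absolutely_integrable_bilinear_continuous[OF h A Suc] by (rule set_lebesgue_integral_eq_integral(1))
    then show ?case using indefinite_integral_continuous_1 unfolding TS by blast
  qed (simp add: T0)
  have hT: "(\<lambda>t. h (A t) (T n t)) integrable_on {a..x}" if "x \<in> {a..c}" for n x
    using absolutely_integrable_bilinear_continuous[OF h A Tc] that
    by (intro integrable_on_subinterval[OF set_lebesgue_integral_eq_integral(1)]) auto
  have Tb: "norm (T n x) \<le> norm y * (?g x ^ n / fact n)" if "x \<in> {a..c}" for n x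
    using that
  proof (induction n arbitrary: x)
    case (Suc n)
    have hi: "((\<lambda>t. norm y * (b t * (?g t ^ n / fact n))) has_integral norm y * (?g x ^ Suc n / fact (Suc n))) {a..x}"
      by (intro has_integral_mult_right integral_power_indefinite_integral[OF bint bpos Suc.prems])
    have "norm (T (Suc n) x) \<le> integral {a..x} (\<lambda>t. norm y * (b t * (?g t ^ n / fact n)))"
      unfolding TS
    proof (rule Henstock_Kurzweil_Integration.integral_norm_bound_integral[OF hT[OF Suc.prems] has_integral_integrable[OF hi]])
      fix t assume "t \<in> {a..x}"
      then have "t \<in> {a..c}" using Suc.prems by simp
      then have "norm (A t) * norm (T n t) * K \<le> norm (A t) * (norm y * (?g t ^ n / fact n)) * K"
        using Suc.IH K by (intro mult_right_mono mult_left_mono) auto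
      then show "norm (h (A t) (T n t)) \<le> norm y * (b t * (?g t ^ n / fact n))"
        using K(2)[of "A t" "T n t"] by (simp add: b_def mult_ac)
    qed
    then show ?case using integral_unique[OF hi] by simp
  qed (simp add: T0)
  have gpos: "0 \<le> ?g x" and gmono: "?g x \<le> ?g c" if "x \<in> {a..c}" for x
    using that bpos integrable_on_subinterval[OF bint, of a x]
    by (auto intro!: integral_nonneg integral_subset_le bint)
  define B where "B n = norm y * (?g c ^ n / fact n)" for n
  have TB: "norm (T n x) \<le> B n" if "x \<in> {a..c}" for n x
  proof -
    have "?g x ^ n / fact n \<le> ?g c ^ n / fact n"
      using gpos gmono that by (intro divide_right_mono power_mono) auto
    then have "norm y * (?g x ^ n / fact n) \<le> B n" unfolding B_def by (rule mult_left_mono) simp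
    then show ?thesis using Tb[OF that, of n] by simp
  qed
  have sB: "summable B" unfolding B_def
    using summable_exp[of "?g c"] by (intro summable_mult) (simp add: divide_inverse mult.commute)
  define Y where "Y x = (\<Sum>n. T n x)" for x
  have lim: "uniform_limit {a..c} (\<lambda>n x. \<Sum>i<n. T i x) Y sequentially"
    unfolding Y_def by (rule Weierstrass_m_test[OF TB sB])
  have Yc: "continuous_on {a..c} Y"
    by (rule uniform_limit_theorem[OF _ lim]) (auto intro!: continuous_on_sum Tc always_eventually)
  have S: "norm (\<Sum>i<n. T i x) \<le> suminf B" if "x \<in> {a..c}" for n x
  proof -
    have "norm (\<Sum>i<n. T i x) \<le> (\<Sum>i<n. B i)" by (rule sum_norm_le) (rule TB[OF that])
    also have "\<dots> \<le> suminf B"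
      by (rule sum_le_suminf[OF sB]) (use TB[OF that] in \<open>auto intro: order_trans[OF norm_ge_zero]\<close>)
    finally show ?thesis .
  qed
  have "Y x = y + integral {a..x} (\<lambda>t. h (A t) (Y t))" if x: "x \<in> {a..c}" for x
  proof -
    have eq: "(\<Sum>i<Suc n. T i x) = y + integral {a..x} (\<lambda>t. h (A t) (\<Sum>i<n. T i t))" for n
    proof -
      have "integral {a..x} (\<lambda>t. h (A t) (\<Sum>i<n. T i t)) = integral {a..x} (\<lambda>t. \<Sum>i<n. h (A t) (T i t))"
        by (simp add: bounded_bilinear.sum_right[OF h])
      also have "\<dots> = (\<Sum>i<n. T (Suc i) x)"
        unfolding TS by (rule Henstock_Kurzweil_Integration.integral_sum) (use hT[OF x] in auto)
      finally show ?thesis unfolding sum.lessThan_Suc_shift T0 by simp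
    qed
    \<comment> \<open>The partial sums are bounded uniformly in n, so \<open>b\<close> times that
      bound is an integrable majorant and the limit passes under the integral.\<close>
    have "(\<lambda>n. integral {a..x} (\<lambda>t. h (A t) (\<Sum>i<n. T i t))) \<longlonglongrightarrow> integral {a..x} (\<lambda>t. h (A t) (Y t))"
    proof (rule dominated_convergence(2)[where h="\<lambda>t. b t * suminf B"])
      fix n
      have "(\<lambda>t. h (A t) (\<Sum>i<n. T i t)) absolutely_integrable_on {a..c}"
        by (rule absolutely_integrable_bilinear_continuous[OF h A]) (intro continuous_on_sum Tc)
      then show "(\<lambda>t. h (A t) (\<Sum>i<n. T i t)) integrable_on {a..x}"
        using x by (intro integrable_on_subinterval[OF set_lebesgue_integral_eq_integral(1)]) auto
      show "(\<lambda>t. b t * suminf B) integrable_on {a..x}"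
        using x by (intro integrable_on_mult_left integrable_on_subinterval[OF bint]) auto
      fix t assume "t \<in> {a..x}"
      then have t: "t \<in> {a..c}" using x by simp
      have "norm (A t) * norm (\<Sum>i<n. T i t) * K \<le> norm (A t) * suminf B * K"
        using S[OF t] K by (intro mult_right_mono mult_left_mono) auto
      then show "norm (h (A t) (\<Sum>i<n. T i t)) \<le> b t * suminf B"
        using K(2)[of "A t" "\<Sum>i<n. T i t"] by (simp add: b_def mult_ac)
    next
      fix t assume "t \<in> {a..x}"
      then have "t \<in> {a..c}" using x by simp
      from tendsto_uniform_limitI[OF lim this]
      have "(\<lambda>n. \<Sum>i<n. T i t) \<longlonglongrightarrow> Y t" .
      then show "(\<lambda>n. h (A t) (\<Sum>i<n. T i t)) \<longlonglongrightarrow> h (A t) (Y t)"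
        by (intro bounded_bilinear.tendsto[OF h] tendsto_const)
    qed
    then have "(\<lambda>n. \<Sum>i<Suc n. T i x) \<longlonglongrightarrow> y + integral {a..x} (\<lambda>t. h (A t) (Y t))"
      unfolding eq by (intro tendsto_intros)
    moreover have "(\<lambda>n. \<Sum>i<Suc n. T i x) \<longlonglongrightarrow> Y x"
      using tendsto_uniform_limitI[OF lim x] by (rule LIMSEQ_Suc)
    ultimately show ?thesis by (rule LIMSEQ_unique[symmetric])
  qed
  with Yc show ?thesis unfolding linear_ode_solution_def by blast
qed

text \<open>The norm of the difference of two solutions satisfies Gronwall's hypothesis with
  constant 0.\<close>

lemma linear_ode_solution_unique:
  fixes h :: "'a::euclidean_space \<Rightarrow> 'b::euclidean_space \<Rightarrow> 'b"
  assumes h: "bounded_bilinear h" and A: "A absolutely_integrable_on {a..c}"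
    and Y: "linear_ode_solution h A a c y Y" and Z: "linear_ode_solution h A a c y Z" and x: "x \<in> {a..c}"
  shows "Y x = Z x"
proof -
  obtain K where K: "K > 0" "\<And>x y. norm (h x y) \<le> norm x * norm y * K"
    using bounded_bilinear.pos_bounded[OF h] by blast
  define b where "b t = K * norm (A t)" for t
  have bint: "b integrable_on {a..c}" and bpos: "\<And>t. 0 \<le> b t"
    using A K unfolding b_def[abs_def] absolutely_integrable_on_def by (auto intro!: integrable_on_mult_right)
  have c: "continuous_on {a..c} Y" "continuous_on {a..c} Z" using Y Z by (auto simp: linear_ode_solution_def)
  have "norm (Y x - Z x) \<le> 0 * exp (integral {a..x} b)"
  proof (rule gronwall[OF bint bpos _ _ x])
    show cn: "continuous_on {a..c} (\<lambda>x. norm (Y x - Z x))" using c by (intro continuous_intros)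
    fix x assume x: "x \<in> {a..c}"
    have i: "(\<lambda>t. h (A t) (V t)) integrable_on {a..x}" if "continuous_on {a..c} V" for V
      using absolutely_integrable_bilinear_continuous[OF h A that] x
      by (intro integrable_on_subinterval[OF set_lebesgue_integral_eq_integral(1)]) auto
    have "b absolutely_integrable_on {a..c}" using bint bpos by (rule nonnegative_absolutely_integrable_1)
    from absolutely_integrable_continuous_mult[OF this cn]
    have i2: "(\<lambda>t. b t * norm (Y t - Z t)) integrable_on {a..x}" using x
      by (intro integrable_on_subinterval[OF set_lebesgue_integral_eq_integral(1)]) auto
    have "Y x = y + integral {a..x} (\<lambda>t. h (A t) (Y t))" "Z x = y + integral {a..x} (\<lambda>t. h (A t) (Z t))"
      using Y Z x unfolding linear_ode_solution_def by blast+
    then have "Y x - Z x = integral {a..x} (\<lambda>t. h (A t) (Y t)) - integral {a..x} (\<lambda>t. h (A t) (Z t))" by simp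
    also have "\<dots> = integral {a..x} (\<lambda>t. h (A t) (Y t) - h (A t) (Z t))"
      by (rule Henstock_Kurzweil_Integration.integral_diff[symmetric]) (intro i c)+
    also have "\<dots> = integral {a..x} (\<lambda>t. h (A t) (Y t - Z t))"
      by (simp add: bounded_bilinear.diff_right[OF h])
    finally have "norm (Y x - Z x) = norm (integral {a..x} (\<lambda>t. h (A t) (Y t - Z t)))" by simp
    also have "\<dots> \<le> integral {a..x} (\<lambda>t. b t * norm (Y t - Z t))"
    proof (rule Henstock_Kurzweil_Integration.integral_norm_bound_integral[OF _ i2])
      show "(\<lambda>t. h (A t) (Y t - Z t)) integrable_on {a..x}" by (intro i continuous_intros c)
      fix t show "norm (h (A t) (Y t - Z t)) \<le> b t * norm (Y t - Z t)"
        using K(2)[of "A t" "Y t - Z t"] by (simp add: b_def mult_ac)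
    qed
    finally show "norm (Y x - Z x) \<le> 0 + integral {a..x} (\<lambda>t. b t * norm (Y t - Z t))" by simp
  qed
  then show ?thesis by simp
qed

lemma AE_lebesgue_on_negligible:
  assumes "negligible N" "\<And>x. x \<in> S - N \<Longrightarrow> P x" "S \<in> sets lebesgue"
  shows "AE x in lebesgue_on S. P x"
proof -
  have "AE x in lebesgue. x \<notin> N" using assms(1) by (auto simp: negligible_iff_null_sets intro: AE_not_in)
  then have "AE x in lebesgue. x \<in> S \<longrightarrow> P x" by (rule AE_mp) (use assms(2) in auto)
  then show ?thesis using assms(3) by (simp add: AE_restrict_space_iff)
qed

lemma negligible_of_AE_lebesgue_on:
  assumes "AE x in lebesgue_on S. P x" "S \<in> sets lebesgue"
  obtains N where "negligible N" "\<And>x. x \<in> S - N \<Longrightarrow> P x"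
proof -
  have "AE x in lebesgue. x \<in> S \<longrightarrow> P x" using assms by (simp add: AE_restrict_space_iff)
  then obtain N where "N \<in> null_sets lebesgue" "{x. \<not> (x \<in> S \<longrightarrow> P x)} \<subseteq> N"
    by (auto simp: eventually_ae_filter)
  then show thesis by (intro that[of N]) (auto simp: negligible_iff_null_sets)
qed

text \<open>Left to right, an indefinite integral is absolutely continuous and has its integrand as
  derivative almost everywhere. Right to left, an absolutely continuous function is recovered from
  that derivative by integration.\<close>

lemma linear_ode_solution_iff_caratheodory:
  fixes h :: "'a::euclidean_space \<Rightarrow> 'b::euclidean_space \<Rightarrow> 'b"
  assumes h: "bounded_bilinear h" and A: "A absolutely_integrable_on {a..c}" and ac: "a \<le> c"
  shows "linear_ode_solution h A a c y Y \<longleftrightarrow> absolutely_continuous_on {a..c} Y \<and> Y a = y \<and>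
     (AE x in lebesgue_on {a..c}. (Y has_vector_derivative h (A x) (Y x)) (at x within {a..c}))"
    (is "?L \<longleftrightarrow> ?R")
proof
  assume L: ?L
  let ?f = "\<lambda>t. h (A t) (Y t)"
  have c: "continuous_on {a..c} Y" and eq: "\<And>x. x \<in> {a..c} \<Longrightarrow> Y x = y + integral {a..x} ?f"
    using L by (auto simp: linear_ode_solution_def)
  have f: "?f absolutely_integrable_on {a..c}" by (rule absolutely_integrable_bilinear_continuous[OF h A c])
  then have fi: "?f integrable_on {a..c}" by (rule set_lebesgue_integral_eq_integral(1))
  have "absolutely_continuous_on {a..c} Y"
    by (rule absolutely_continuous_on_lipschitz[OF absolutely_continuous_on_indefinite_integral[OF f], of 1])
      (use eq in auto)
  moreover have "Y a = y" using eq[of a] ac by simp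
  moreover obtain N where N: "negligible N"
    "\<And>x. x \<in> {a..c} - N \<Longrightarrow> ((\<lambda>u. integral {a..u} ?f) has_vector_derivative ?f x) (at x within {a..c})"
    using indefinite_integral_has_vector_derivative_ae[OF fi] by blast
  have "(Y has_vector_derivative ?f x) (at x within {a..c})" if "x \<in> {a..c} - N" for x
  proof (rule has_vector_derivative_transform)
    show "x \<in> {a..c}" using that by simp
    show "Y x = y + integral {a..x} ?f" if "x \<in> {a..c}" for x using eq[OF that] .
    show "((\<lambda>x. y + integral {a..x} ?f) has_vector_derivative ?f x) (at x within {a..c})"
      using N(2)[OF that] by (auto intro!: derivative_eq_intros)
  qed
  then have "AE x in lebesgue_on {a..c}. (Y has_vector_derivative ?f x) (at x within {a..c})"
    by (rule AE_lebesgue_on_negligible[OF N(1)]) auto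
  ultimately show ?R by blast
next
  assume R: ?R
  then have ac': "absolutely_continuous_on {a..c} Y" by blast
  have c: "continuous_on {a..c} Y" by (rule absolutely_continuous_on_imp_continuous_on[OF ac'])
  obtain N where N: "negligible N"
    "\<And>x. x \<in> {a..c} - N \<Longrightarrow> (Y has_vector_derivative h (A x) (Y x)) (at x within {a..c})"
    using negligible_of_AE_lebesgue_on[OF conjunct2[OF conjunct2[OF R]]] by auto
  have "Y x = y + integral {a..x} (\<lambda>t. h (A t) (Y t))" if x: "x \<in> {a..c}" for x
  proof -
    have "((\<lambda>t. h (A t) (Y t)) has_integral Y x - Y a) {a..x}"
    proof (rule has_integral_absolutely_continuous[OF _ _ N(1)])
      show "absolutely_continuous_on {a..x} Y"
        using ac' x unfolding absolutely_continuous_on_def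
        by (meson atLeastatMost_subset_iff atLeastAtMost_iff order_refl subset_trans)
      fix t assume "t \<in> {a..x} - N"
      then show "(Y has_vector_derivative h (A t) (Y t)) (at t within {a..x})"
        using x by (intro has_vector_derivative_within_subset[OF N(2)]) auto
    qed (use x in auto)
    then show ?thesis using R by (auto dest: integral_unique)
  qed
  with c show ?L by (simp add: linear_ode_solution_def)
qed

section \<open>Monodromy matrices of canonical systems\<close>

lemma bounded_bilinear_matrix_matrix_mult:
  "bounded_bilinear ((**) :: complex^'n^'m \<Rightarrow> complex^'k^'n \<Rightarrow> complex^'k^'m)"
  unfolding bilinear_conv_bounded_bilinear[symmetric] bilinear_def
  by (auto intro!: linearI simp:
      vec_eq_iff matrix_matrix_mult_def scaleR_sum_right sum.distrib algebra_simps)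

lemma bounded_bilinear_matrix_vector_mult:
  "bounded_bilinear ((*v) :: complex^'n^'m \<Rightarrow> complex^'n \<Rightarrow> complex^'m)"
  unfolding bilinear_conv_bounded_bilinear[symmetric] bilinear_def
  by (auto intro!: linearI simp: 
      vec_eq_iff matrix_vector_mult_def scaleR_sum_right sum.distrib algebra_simps)

lemmas bounded_linear_matrix_vector_mult = bounded_bilinear.bounded_linear_right[OF bounded_bilinear_matrix_vector_mult]

lemma norm_matrix_vector_le_opnorm: "norm (A *v v) \<le> opnorm A * norm v"
  unfolding opnorm_def by (rule onorm[OF bounded_linear_matrix_vector_mult])

lemma opnorm_nonneg: "0 \<le> opnorm A"
  unfolding opnorm_def by (rule onorm_pos_le[OF bounded_linear_matrix_vector_mult])

lemma opnorm_le: "(\<And>v. norm (A *v v) \<le> b * norm v) \<Longrightarrow> opnorm A \<le> b"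
  unfolding opnorm_def by (rule onorm_le)

lemma opnorm_0: "opnorm 0 = 0"
  by (simp add: opnorm_def onorm_zero)

lemma opnorm_triangle: "opnorm (A + B) \<le> opnorm A + opnorm B"
  unfolding opnorm_def matrix_vector_mult_add_rdistrib
  by (rule onorm_triangle) (rule bounded_linear_matrix_vector_mult)+

lemma opnorm_le_norm: obtains K where "K > 0" "\<And>A. opnorm A \<le> K * norm A"
proof -
  obtain K where K: "K > 0" "\<And>(A::complex^2^2) (v::complex^2). norm (A *v v) \<le> norm A * norm v * K"
    using bounded_bilinear.pos_bounded[OF bounded_bilinear_matrix_vector_mult] by blast
  show thesis
    by (rule that[OF K(1)], rule opnorm_le) (use K(2) in \<open>simp add: mult_ac\<close>)
qed

text \<open>Needed for measurability of \<open>opnorm (H t)\<close> in t.\<close>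

lemma continuous_on_opnorm: "continuous_on UNIV opnorm"
proof -
  obtain K where K: "K > 0" "\<And>A. opnorm A \<le> K * norm A" using opnorm_le_norm by blast
  have le: "opnorm A - opnorm B \<le> K * norm (A - B)" for A B
    using opnorm_triangle[of B "A - B"] K(2)[of "A - B"] by simp
  have "K-lipschitz_on UNIV opnorm"
    by (rule lipschitz_onI)
      (use le K(1) in \<open>auto simp: dist_norm abs_le_iff minus_diff_eq intro: order_trans[OF le] simp: norm_minus_commute\<close>)
  then show ?thesis by (rule lipschitz_on_continuous_on)
qed

lemma absolutely_integrable_opnorm:
  assumes "H absolutely_integrable_on S" "S \<in> sets lebesgue"
  shows "(\<lambda>t. opnorm (H t)) absolutely_integrable_on S"
proof -
  obtain K where K: "K > 0" "\<And>A. opnorm A \<le> K * norm A" using opnorm_le_norm by blast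
  have "H \<in> borel_measurable (lebesgue_on S)"
    using assms by (rule absolutely_integrable_imp_borel_measurable)
  then have "(\<lambda>t. opnorm (H t)) \<in> borel_measurable (lebesgue_on S)"
    by (rule borel_measurable_continuous_on[OF continuous_on_opnorm])
  moreover have "(\<lambda>t. norm (H t)) integrable_on S"
    using assms by (auto simp: absolutely_integrable_on_def)
  then have "(\<lambda>t. K * norm (H t)) integrable_on S" by (rule integrable_on_mult_right)
  ultimately show ?thesis
    by (rule measurable_bounded_by_integrable_imp_absolutely_integrable[OF _ assms(2)])
      (use K opnorm_nonneg in auto)
qed

lemma norm_vector_smult: "norm (z *s v) = norm z * norm (v :: complex^'n)"
  unfolding norm_vec_def by (simp add: norm_mult L2_set_right_distrib)

lemma mat_mult_vector: "(mat z ** A) *v v = z *s (A *v (v::complex^'n))"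
  by (simp add: matrix_vector_mul_assoc[symmetric])
    (simp add: vec_eq_iff matrix_vector_mult_def mat_def if_distrib[where f="\<lambda>x. x * _"] cong: if_cong)

lemma J_mult: "J *v v = vector [- (v $ 2), v $ 1]"
  by (simp add: J_def vec_eq_iff matrix_vector_mult_def sum_2 forall_2)

lemma norm_J_mult: "norm (J *v v) = norm v"
  by (simp add: J_mult norm_vec_def L2_set_def sum_2 add.commute)

lemma uminus_matrix_vector: "(- A) *v v = - (A *v (v :: complex^'n))"
  by (simp add: vec_eq_iff matrix_vector_mult_def sum_negf)

lemma J_J: "J ** J = - mat 1"
  by (simp add: J_def vec_eq_iff matrix_matrix_mult_def sum_2 forall_2 mat_def)

text \<open>\<open>- J\<close> is the inverse of \<open>J\<close>, as J squared is minus the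
  identity. This solves the canonical equation for the derivative and brings it to the form Y' = A
  Y.\<close>

lemma J_cancel: "J ** D = X \<longleftrightarrow> D = (- J) ** X"
proof -
  have neg: "(- A) ** B = - (A ** B)" "A ** (- B) = - (A ** B)" for A B :: "complex^2^2"
    by (simp_all add: vec_eq_iff matrix_matrix_mult_def sum_negf)
  have "(- J) ** (J ** D) = D" "J ** ((- J) ** X) = X"
    by (simp_all add: neg matrix_mul_assoc J_J)
  then show ?thesis by metis
qed

section \<open>Solutions of the canonical system and their value at L\<close>

definition coeff :: "(real \<Rightarrow> complex^2^2) \<Rightarrow> complex \<Rightarrow> real \<Rightarrow> complex^2^2" where
  "coeff H z t = (- J) ** (mat z ** H t)"

lemma coeff_mult: "coeff H z t *v v = - (J *v (z *s (H t *v v)))"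
  by (simp add: coeff_def matrix_vector_mul_assoc[symmetric] uminus_matrix_vector mat_mult_vector[symmetric])

lemma canonical_system_absolutely_integrable:
  assumes "canonical_system H L"
  shows "H absolutely_integrable_on {0..L}"
  using assms by (simp add: canonical_system_def integrable_restrict_space set_integrable_def)

lemma absolutely_integrable_coeff:
  assumes "canonical_system H L"
  shows "coeff H z absolutely_integrable_on {0..L}"
proof -
  note bl = bounded_bilinear.bounded_linear_right[OF bounded_bilinear_matrix_matrix_mult]
  have "bounded_linear (\<lambda>X::complex^2^2. (- J) ** (mat z ** X))"
    by (rule bounded_linear_compose[OF bl bl])
  from absolutely_integrable_linear[OF canonical_system_absolutely_integrable[OF assms] this]
  show ?thesis by (simp add: o_def coeff_def[abs_def])
qed

abbreviation ode_solution :: "(real \<Rightarrow> complex^2^2) \<Rightarrow> real \<Rightarrow> complex \<Rightarrow> (real \<Rightarrow> complex^2^2) \<Rightarrow> bool" where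
  "ode_solution H L z \<equiv> linear_ode_solution (**) (coeff H z) 0 L (mat 1)"

lemma matrix_solution_iff:
  assumes "canonical_system H L"
  shows "matrix_solution H L z M \<longleftrightarrow> ode_solution H L z M"
proof -
  have L: "0 \<le> L" using assms by (simp add: canonical_system_def)
  have "(\<exists>D. (M has_vector_derivative D) (at x within {0..L}) \<and> J ** D = mat z ** (H x ** M x))
      \<longleftrightarrow> (M has_vector_derivative coeff H z x ** M x) (at x within {0..L})" for x
    by (simp add: J_cancel coeff_def matrix_mul_assoc)
  then show ?thesis
    unfolding matrix_solution_def
      linear_ode_solution_iff_caratheodory[OF bounded_bilinear_matrix_matrix_mult absolutely_integrable_coeff[OF assms] L]
    by simp
qed

text \<open>Discharges the definite description: by uniqueness the value at \<open>L\<close> does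
  not depend on the solution, so estimates may be made on any one of them.\<close>

lemma monodromy_eq:
  assumes H: "canonical_system H L" and M: "ode_solution H L z M"
  shows "monodromy H L z = M L"
  unfolding monodromy_def
proof (rule the_equality)
  show "\<exists>M'. matrix_solution H L z M' \<and> M L = M' L" using M matrix_solution_iff[OF H] by blast
  fix A assume "\<exists>M'. matrix_solution H L z M' \<and> A = M' L"
  then obtain M' where "ode_solution H L z M'" "A = M' L" using matrix_solution_iff[OF H] by blast
  moreover have "L \<in> {0..L}" using H by (simp add: canonical_system_def)
  ultimately show "A = M L"
    using linear_ode_solution_unique[OF bounded_bilinear_matrix_matrix_mult absolutely_integrable_coeff[OF H] M]
    by metis
qed

lemma ode_solution_exists:
  assumes "canonical_system H L"
  obtains M where "ode_solution H L z M"
  using linear_ode_solution_exists[OF bounded_bilinear_matrix_matrix_mult absolutely_integrable_coeff[OF assms]]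
  by blast

lemma ode_solution_increment:
  assumes H: "canonical_system H L" and M: "ode_solution H L z M" and ab: "0 \<le> \<alpha>" "\<alpha> \<le> \<beta>" "\<beta> \<le> L"
  shows "((\<lambda>t. coeff H z t *v (M t *v v)) has_integral M \<beta> *v v - M \<alpha> *v v) {\<alpha>..\<beta>}"
proof -
  have c: "continuous_on {0..L} M" and eq: "\<And>x. x \<in> {0..L} \<Longrightarrow> M x = mat 1 + integral {0..x} (\<lambda>t. coeff H z t ** M t)"
    using M by (auto simp: linear_ode_solution_def)
  have i: "(\<lambda>t. coeff H z t ** M t) integrable_on {0..L}"
    using absolutely_integrable_bilinear_continuous[OF bounded_bilinear_matrix_matrix_mult absolutely_integrable_coeff[OF H] c]
    by (rule set_lebesgue_integral_eq_integral(1))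
  have "M \<beta> - M \<alpha> = integral {\<alpha>..\<beta>} (\<lambda>t. coeff H z t ** M t)"
    using eq[of \<alpha>] eq[of \<beta>] indefinite_integral_diff_real[OF i, of \<alpha> \<beta>] ab by simp
  moreover have "(\<lambda>t. coeff H z t ** M t) integrable_on {\<alpha>..\<beta>}"
    using ab by (intro integrable_on_subinterval[OF i]) auto
  ultimately have "((\<lambda>t. coeff H z t ** M t) has_integral M \<beta> - M \<alpha>) {\<alpha>..\<beta>}"
    by (metis integrable_integral)
  from has_integral_linear[OF this bounded_bilinear.bounded_linear_left[OF bounded_bilinear_matrix_vector_mult], of v]
  show ?thesis by (simp add: o_def matrix_vector_mul_assoc matrix_vector_mult_diff_rdistrib)
qed

lemma ode_solution_continuous:
  assumes "ode_solution H L z M"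
  shows "continuous_on {0..L} (\<lambda>t. M t *v v)"
  using assms unfolding linear_ode_solution_def
  by (intro bounded_linear.continuous_on[OF bounded_bilinear.bounded_linear_left[OF bounded_bilinear_matrix_vector_mult]]) blast

text \<open>\<open>T\<close> encodes a change of norm: the identity gives the crude bound,
  \<open>gauge_transform\<close> the refined one. Being constant in t and linear, it commutes with
  the integral equation.\<close>

lemma ode_solution_gronwall:
  fixes T :: "complex^2 \<Rightarrow> complex^2"
  assumes H: "canonical_system H L" and M: "ode_solution H L z M" and ab: "0 \<le> \<alpha>" "\<alpha> \<le> \<beta>" "\<beta> \<le> L"
    and T: "bounded_linear T" and b: "b integrable_on {\<alpha>..\<beta>}" and pos: "\<And>t. t \<in> {\<alpha>..\<beta>} \<Longrightarrow> 0 \<le> b t"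
    and le: "\<And>t y. t \<in> {\<alpha>..\<beta>} \<Longrightarrow> norm (T (coeff H z t *v y)) \<le> b t * norm (T y)"
  shows "norm (T (M \<beta> *v v)) \<le> norm (T (M \<alpha> *v v)) * exp (integral {\<alpha>..\<beta>} b)"
proof (rule gronwall[OF b pos])
  let ?Y = "\<lambda>t. M t *v v"
  have "continuous_on {\<alpha>..\<beta>} ?Y" using ab by (intro continuous_on_subset[OF ode_solution_continuous[OF M]]) auto
  then show c: "continuous_on {\<alpha>..\<beta>} (\<lambda>t. norm (T (?Y t)))"
    by (intro continuous_on_norm bounded_linear.continuous_on[OF T])
  show "\<beta> \<in> {\<alpha>..\<beta>}" using ab by simp
  fix x assume x: "x \<in> {\<alpha>..\<beta>}"
  then have "((\<lambda>t. coeff H z t *v ?Y t) has_integral ?Y x - ?Y \<alpha>) {\<alpha>..x}"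
    using ab by (intro ode_solution_increment[OF H M]) auto
  from has_integral_linear[OF this T]
  have hi: "((\<lambda>t. T (coeff H z t *v ?Y t)) has_integral T (?Y x) - T (?Y \<alpha>)) {\<alpha>..x}"
    by (simp add: o_def linear_diff[OF bounded_linear.linear[OF T]])
  have "b absolutely_integrable_on {\<alpha>..\<beta>}" using b pos by (rule nonnegative_absolutely_integrable_1)
  from absolutely_integrable_continuous_mult[OF this c]
  have bi: "(\<lambda>t. b t * norm (T (?Y t))) integrable_on {\<alpha>..x}"
    using x by (intro integrable_on_subinterval[OF set_lebesgue_integral_eq_integral(1)]) auto
  have "norm (T (?Y x) - T (?Y \<alpha>)) \<le> integral {\<alpha>..x} (\<lambda>t. b t * norm (T (?Y t)))"
    unfolding integral_unique[OF hi, symmetric]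
    by (rule Henstock_Kurzweil_Integration.integral_norm_bound_integral[OF has_integral_integrable[OF hi] bi])
      (use x le in auto)
  then show "norm (T (?Y x)) \<le> norm (T (?Y \<alpha>)) + integral {\<alpha>..x} (\<lambda>t. b t * norm (T (?Y t)))"
    using norm_triangle_sub[of "T (?Y x)" "T (?Y \<alpha>)"] by linarith
qed

lemma norm_coeff_mult: "norm (coeff H z t *v v) = norm z * norm (H t *v v)"
  by (simp add: coeff_mult norm_J_mult norm_vector_smult)

text \<open>Serves for the bounded range of z in which no approximant is provided.\<close>

lemma opnorm_monodromy_le:
  assumes H: "canonical_system H L"
  obtains c where "c > 0" "\<And>z. opnorm (monodromy H L z) \<le> exp (c * norm z)"
proof -
  let ?h = "\<lambda>t. opnorm (H t)"
  define c where "c = integral {0..L} ?h + 1"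
  have L: "0 < L" using H by (simp add: canonical_system_def)
  have hi: "?h integrable_on {0..L}"
    using absolutely_integrable_opnorm[OF canonical_system_absolutely_integrable[OF H]]
    by (auto intro: set_lebesgue_integral_eq_integral(1))
  then have i0: "0 \<le> integral {0..L} ?h" by (rule integral_nonneg) (rule opnorm_nonneg)
  have "opnorm (monodromy H L z) \<le> exp (c * norm z)" for z
  proof -
    obtain M where M: "ode_solution H L z M" using ode_solution_exists[OF H] .
    have M0: "M 0 = mat 1" using M L by (auto simp: linear_ode_solution_def)
    have "norm (M L *v v) \<le> exp (c * norm z) * norm v" for v
    proof -
      have "norm (M L *v v) \<le> norm (M 0 *v v) * exp (integral {0..L} (\<lambda>t. norm z * ?h t))"
      proof (rule ode_solution_gronwall[OF H M, where T="\<lambda>x. x"])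
        show "(\<lambda>t. norm z * ?h t) integrable_on {0..L}" using hi by (rule integrable_on_mult_right)
        fix t y show "norm (coeff H z t *v y) \<le> norm z * ?h t * norm y"
          unfolding norm_coeff_mult using mult_left_mono[OF norm_matrix_vector_le_opnorm[of "H t" y], of "norm z"]
          by (simp add: mult_ac)
      qed (use L opnorm_nonneg in auto)
      also have "\<dots> \<le> norm v * exp (c * norm z)"
        unfolding M0 by (intro mult_mono) (simp_all add: c_def algebra_simps)
      finally show ?thesis by (simp add: mult.commute)
    qed
    then show ?thesis unfolding monodromy_eq[OF H M] by (rule opnorm_le)
  qed
  then show thesis using i0 by (intro that[of c]) (auto simp: c_def)
qed

section \<open>Gauge transforms and the upper bound\<close>

lemma rank_one_idem:
  assumes "norm e = 1"
  shows "rank_one e *v (rank_one e *v v) = rank_one e *v v"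
proof -
  have "(e $ 1)\<^sup>2 + (e $ 2)\<^sup>2 = 1"
    using assms by (simp add: norm_vec_def L2_set_def sum_2)
  then have "complex_of_real ((e $ 1)\<^sup>2 + (e $ 2)\<^sup>2) = 1" by simp
  then have "cdot (cvec e) (cvec e) = 1" by (simp add: cdot_def cvec_def sum_2 power2_eq_square)
  moreover have "cdot (c *s w) u = c * cdot w u" for c w u by (simp add: cdot_def sum_2 algebra_simps)
  ultimately show ?thesis by (simp add: rank_one_apply)
qed

text \<open>The scalar in the middle is e^T J e, which vanishes because \<open>J\<close> is
  antisymmetric and \<open>e\<close> is real. Thus J P has square zero, and a rank one piece by
  itself causes no exponential growth.\<close>

lemma rank_one_J_rank_one: "rank_one e *v (J *v (z *s (rank_one e *v v))) = 0"
  by (simp add: rank_one_apply J_mult cdot_def cvec_def sum_2 vec_eq_iff forall_2 algebra_simps)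

text \<open>Pythagoras: the projection is a self-adjoint idempotent, so its range is orthogonal to
  the range of its complement.\<close>

lemma norm_rank_one_combination:
  assumes "norm e = 1"
  shows "norm (\<alpha> *\<^sub>R (rank_one e *v v) + \<beta> *\<^sub>R (v - rank_one e *v v)) ^ 2
    = \<alpha>\<^sup>2 * norm (rank_one e *v v) ^ 2 + \<beta>\<^sup>2 * norm (v - rank_one e *v v) ^ 2"
proof -
  let ?P = "\<lambda>v. rank_one e *v v"
  have inner: "inner u w = Re (cdot u w)" for u w
    by (simp add: inner_vec_def cdot_def inner_complex_def sum_2)
  have "cdot (?P u) w = cdot u (?P w)" for u w
    by (simp add: rank_one_apply cdot_def cvec_def sum_2 algebra_simps)
  then have "inner (?P v) (v - ?P v) = Re (cdot v (?P (v - ?P v)))" by (simp add: inner)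
  also have "?P (v - ?P v) = 0" by (simp add: matrix_vector_mult_diff_distrib rank_one_idem[OF assms])
  finally have orth: "inner (?P v) (v - ?P v) = 0" by (simp add: cdot_def)
  show ?thesis unfolding power2_norm_eq_inner
    by (simp only: inner_add_left inner_add_right inner_scaleR_left inner_scaleR_right orth
        inner_commute[of "v - ?P v" "?P v"] power2_eq_square) simp
qed

lemma norm_rank_one_combination_le:
  assumes e: "norm e = 1" and \<alpha>: "\<bar>\<alpha>\<bar> \<le> m" and \<beta>: "\<bar>\<beta>\<bar> \<le> m"
  shows "norm (\<alpha> *\<^sub>R (rank_one e *v v) + \<beta> *\<^sub>R (v - rank_one e *v v)) \<le> m * norm v"
proof -
  have m: "0 \<le> m" using \<alpha> by simp
  have "\<alpha>\<^sup>2 \<le> m\<^sup>2" "\<beta>\<^sup>2 \<le> m\<^sup>2" using \<alpha> \<beta> m by (auto simp: abs_le_square_iff[symmetric])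
  then have "norm (\<alpha> *\<^sub>R (rank_one e *v v) + \<beta> *\<^sub>R (v - rank_one e *v v)) ^ 2
     \<le> m\<^sup>2 * norm (rank_one e *v v) ^ 2 + m\<^sup>2 * norm (v - rank_one e *v v) ^ 2"
    unfolding norm_rank_one_combination[OF e] by (intro add_mono mult_right_mono) auto
  also have "\<dots> = m\<^sup>2 * norm v ^ 2"
    using norm_rank_one_combination[OF e, of 1 v 1] by (simp add: algebra_simps)
  finally have "norm (\<alpha> *\<^sub>R (rank_one e *v v) + \<beta> *\<^sub>R (v - rank_one e *v v)) ^ 2 \<le> (m * norm v) ^ 2"
    by (simp add: power_mult_distrib)
  then show ?thesis by (rule power2_le_imp_le) (simp add: m)
qed

text \<open>For a unit vector \<open>e\<close> this is the diagonal matrix with entries 1/a and a in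
  an orthonormal basis starting with \<open>e\<close>; replacing a by 1/a inverts it.\<close>

definition gauge_transform :: "real \<Rightarrow> real^2 \<Rightarrow> complex^2 \<Rightarrow> complex^2" where
  "gauge_transform a e v = (1 / a) *\<^sub>R (rank_one e *v v) + a *\<^sub>R (v - rank_one e *v v)"

lemma bounded_linear_gauge_transform: "bounded_linear (gauge_transform a e)"
  unfolding gauge_transform_def[abs_def]
  by (intro bounded_linear_add bounded_linear_const_scaleR bounded_linear_sub
      bounded_linear_matrix_vector_mult bounded_linear_ident)

lemma rank_one_gauge_transform:
  assumes "norm e = 1"
  shows "rank_one e *v gauge_transform a e v = (1 / a) *\<^sub>R (rank_one e *v v)"
proof -
  have sc: "A *v (r *\<^sub>R u) = r *\<^sub>R (A *v u)" for A :: "complex^2^2" and r :: real and u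
    by (rule linear_cmul[OF bounded_linear.linear[OF bounded_linear_matrix_vector_mult]])
  show ?thesis
    by (simp add: gauge_transform_def matrix_vector_right_distrib matrix_vector_mult_diff_distrib sc
        rank_one_idem[OF assms])
qed

lemma gauge_transform_inverse:
  assumes "norm e = 1" "a > 0"
  shows "gauge_transform (1 / a) e (gauge_transform a e v) = v"
  unfolding gauge_transform_def[of "1 / a"] rank_one_gauge_transform[OF assms(1)]
  using assms(2) by (simp add: gauge_transform_def algebra_simps)

lemma norm_gauge_transform_le:
  assumes "norm e = 1" "0 < a" "a \<le> 1"
  shows "norm (gauge_transform a e v) \<le> (1 / a) * norm v"
    and "norm v \<le> (1 / a) * norm (gauge_transform a e v)"
proof -
  have "a * a \<le> 1 * 1" using assms by (intro mult_mono) auto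
  then have a: "a \<le> 1 / a" using assms by (simp add: field_simps)
  show "norm (gauge_transform a e v) \<le> (1 / a) * norm v"
    unfolding gauge_transform_def by (rule norm_rank_one_combination_le) (use assms a in auto)
  have "norm (gauge_transform (1 / a) e (gauge_transform a e v)) \<le> (1 / a) * norm (gauge_transform a e v)"
    unfolding gauge_transform_def[of "1 / a"] by (rule norm_rank_one_combination_le) (use assms a in auto)
  then show "norm v \<le> (1 / a) * norm (gauge_transform a e v)"
    using gauge_transform_inverse assms by simp
qed

lemma norm_rank_one_le: "norm e = 1 \<Longrightarrow> norm (rank_one e *v v) \<le> norm v"
  using norm_rank_one_combination_le[of e 1 1 0 v] by simp

text \<open>In the gauge, the rank one part of the Hamiltonian is damped by \<open>a\<^sup>2\<close> while the error is
  amplified by at most \<open>1/a\<^sup>2\<close>.\<close>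

lemma norm_gauge_transform_coeff:
  assumes e: "norm e = 1" and a: "0 < a" "a \<le> 1"
  shows "norm (gauge_transform a e (coeff H z t *v y))
    \<le> norm z * (a\<^sup>2 + opnorm (H t - rank_one e) / a\<^sup>2) * norm (gauge_transform a e y)"
proof -
  let ?P = "rank_one e" and ?w = "gauge_transform a e y"
  let ?E = "- (J *v (z *s ((H t - ?P) *v y)))"
  have split: "coeff H z t *v y = - (J *v (z *s (?P *v y))) + ?E"
    by (simp add: coeff_mult matrix_vector_mult_diff_rdistrib vector_ssub_ldistrib matrix_vector_mult_diff_distrib)
  have neg: "A *v (- u) = - (A *v u)" for A :: "complex^2^2" and u
    using linear_neg[OF bounded_linear.linear[OF bounded_linear_matrix_vector_mult]] .
  \<comment> \<open>One factor \<open>a\<close> arises from expressing P y through the gauged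
    vector, the second because J P y is orthogonal to \<open>e\<close> and the gauge multiplies it
    by \<open>a\<close>.\<close>
  have Py: "?P *v y = a *\<^sub>R (?P *v ?w)"
    using a by (simp add: rank_one_gauge_transform[OF e])
  have "gauge_transform a e (- (J *v (z *s (?P *v y)))) = a *\<^sub>R (- (J *v (z *s (?P *v y))))"
    by (simp add: gauge_transform_def neg rank_one_J_rank_one)
  then have 1: "norm (gauge_transform a e (- (J *v (z *s (?P *v y))))) \<le> norm z * a\<^sup>2 * norm ?w"
    using a norm_rank_one_le[OF e, of ?w]
    by (simp add: norm_J_mult norm_vector_smult Py power2_eq_square mult_left_mono mult_ac)
  \<comment> \<open>The error has no preferred direction: applying the gauge costs 1/a, undoing it
    on y costs another 1/a.\<close>
  have "norm (gauge_transform a e ?E) \<le> (1 / a) * norm ?E" by (rule norm_gauge_transform_le[OF e a])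
  also have "norm ?E = norm z * norm ((H t - ?P) *v y)" by (simp add: norm_J_mult norm_vector_smult)
  also have "\<dots> \<le> norm z * (opnorm (H t - ?P) * ((1 / a) * norm ?w))"
    using norm_matrix_vector_le_opnorm[of "H t - ?P" y]
      mult_left_mono[OF norm_gauge_transform_le(2)[OF e a, of y] opnorm_nonneg[of "H t - ?P"]]
    by (intro mult_left_mono) auto
  finally have 2: "norm (gauge_transform a e ?E) \<le> norm z * (opnorm (H t - ?P) / a\<^sup>2) * norm ?w"
    using a by (simp add: divide_right_mono power2_eq_square mult_ac)
  have "gauge_transform a e (coeff H z t *v y) = gauge_transform a e (- (J *v (z *s (?P *v y)))) + gauge_transform a e ?E"
    unfolding split by (rule linear_add[OF bounded_linear.linear[OF bounded_linear_gauge_transform]])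
  then show ?thesis using 1 2 norm_triangle_ineq[of "gauge_transform a e (- (J *v (z *s (?P *v y))))" "gauge_transform a e ?E"]
    by (simp add: algebra_simps)
qed

lemma gauge_transform_step:
  assumes H: "canonical_system H L" and M: "ode_solution H L z M" and ab: "0 \<le> \<alpha>" "\<alpha> \<le> \<beta>" "\<beta> \<le> L"
    and e: "norm e = 1" and a: "0 < a" "a \<le> 1" and G: "\<And>t. t \<in> {\<alpha><..<\<beta>} \<Longrightarrow> G t = rank_one e"
  shows "norm (gauge_transform a e (M \<beta> *v v)) \<le> norm (gauge_transform a e (M \<alpha> *v v)) *
     exp (norm z * (a\<^sup>2 * (\<beta> - \<alpha>) + 1 / a\<^sup>2 * integral\<^sup>L (lebesgue_on {\<alpha>..\<beta>}) (\<lambda>t. opnorm (H t - G t))))"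
proof -
  define p where "p t = opnorm (H t - rank_one e)" for t
  have "(\<lambda>t. H t - rank_one e) absolutely_integrable_on {\<alpha>..\<beta>}"
    using ab by (intro set_integral_diff absolutely_integrable_on_subinterval[OF canonical_system_absolutely_integrable[OF H]]) auto
  then have pabs: "p absolutely_integrable_on {\<alpha>..\<beta>}"
    unfolding p_def[abs_def] by (rule absolutely_integrable_opnorm) simp
  then have pi: "p integrable_on {\<alpha>..\<beta>}" by (rule set_lebesgue_integral_eq_integral(1))
  \<comment> \<open>\<open>G\<close> is prescribed only on the open interval; the two endpoints form
    a null set.\<close>
  have "(\<lambda>t. opnorm (H t - G t)) absolutely_integrable_on {\<alpha>..\<beta>}"
    by (rule absolutely_integrable_spike[OF pabs, of "{\<alpha>, \<beta>}"]) (auto simp: p_def G)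
  then have "integral\<^sup>L (lebesgue_on {\<alpha>..\<beta>}) (\<lambda>t. opnorm (H t - G t)) = integral {\<alpha>..\<beta>} (\<lambda>t. opnorm (H t - G t))"
    by (intro lebesgue_integral_eq_integral) (simp_all add: integrable_restrict_space set_integrable_def)
  also have "\<dots> = integral {\<alpha>..\<beta>} p"
    by (rule integral_spike[of "{\<alpha>, \<beta>}"]) (auto simp: p_def G)
  finally have eq: "integral\<^sup>L (lebesgue_on {\<alpha>..\<beta>}) (\<lambda>t. opnorm (H t - G t)) = integral {\<alpha>..\<beta>} p" .
  let ?b = "\<lambda>t. norm z * (a\<^sup>2 + p t / a\<^sup>2)"
  have bi: "(?b has_integral norm z * (a\<^sup>2 * (\<beta> - \<alpha>) + integral {\<alpha>..\<beta>} p / a\<^sup>2)) {\<alpha>..\<beta>}"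
    using ab has_integral_const_real[of "a\<^sup>2" \<alpha> \<beta>]
    by (intro has_integral_mult_right has_integral_add has_integral_divide integrable_integral pi)
      (simp_all add: mult.commute)
  have "norm (gauge_transform a e (M \<beta> *v v)) \<le> norm (gauge_transform a e (M \<alpha> *v v)) * exp (integral {\<alpha>..\<beta>} ?b)"
    by (rule ode_solution_gronwall[OF H M ab bounded_linear_gauge_transform has_integral_integrable[OF bi]])
      (use norm_gauge_transform_coeff[OF e a] in \<open>auto simp: p_def opnorm_nonneg\<close>)
  then show ?thesis unfolding integral_unique[OF bi] eq by simp
qed

text \<open>For equal projections the change of gauge is diagonal with entries a/a' and a'/a, both
  at most m = exp |ln (a'/a)|. The rest contains P - P', with a factor at most 1/a' from the new
  gauge and 1/a from undoing the old one. Since m \<ge> 1, the sum m + q is at most m (1 + q), which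
  makes the exponents add up.\<close>

lemma gauge_transform_change:
  assumes e: "norm e = 1" and a: "0 < a" "a \<le> 1" and a': "0 < a'" "a' \<le> 1"
  shows "norm (gauge_transform a' e' v) \<le> norm (gauge_transform a e v) *
     exp (\<bar>ln (a' / a)\<bar> + ln (1 + opnorm (rank_one e - rank_one e') / (a * a')))"
proof -
  let ?P = "rank_one e" and ?P' = "rank_one e'" and ?u = "gauge_transform a e v"
  define \<delta> where "\<delta> = opnorm (?P - ?P')"
  have \<delta>: "0 \<le> \<delta> / (a * a')" using opnorm_nonneg a a' by (simp add: \<delta>_def)
  define m where "m = exp \<bar>ln (a' / a)\<bar>"
  have "exp (- ln (a' / a)) \<le> m" "exp (ln (a' / a)) \<le> m" and m1: "1 \<le> m"
    unfolding m_def by simp_all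
  then have m: "a / a' \<le> m" "a' / a \<le> m" "1 \<le> m"
    using a a' by (simp_all add: exp_minus)
  have v: "v = a *\<^sub>R (?P *v ?u) + (1 / a) *\<^sub>R (?u - ?P *v ?u)"
    using gauge_transform_inverse[OF e a(1), of v] by (simp add: gauge_transform_def[of "1 / a"])
  have P: "?P *v v = a *\<^sub>R (?P *v ?u)"
    using a by (simp add: rank_one_gauge_transform[OF e])
  have Q: "v - ?P *v v = (1 / a) *\<^sub>R (?u - ?P *v ?u)" unfolding P by (subst v) simp
  have "gauge_transform a' e' v = ((1 / a') *\<^sub>R (?P *v v) + a' *\<^sub>R (v - ?P *v v)) - (1 / a' - a') *\<^sub>R ((?P - ?P') *v v)"
    by (simp add: gauge_transform_def matrix_vector_mult_diff_rdistrib algebra_simps)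
  also have "(1 / a') *\<^sub>R (?P *v v) + a' *\<^sub>R (v - ?P *v v) = (a / a') *\<^sub>R (?P *v ?u) + (a' / a) *\<^sub>R (?u - ?P *v ?u)"
    unfolding Q unfolding P by simp
  finally have "norm (gauge_transform a' e' v) \<le> norm ((a / a') *\<^sub>R (?P *v ?u) + (a' / a) *\<^sub>R (?u - ?P *v ?u))
     + norm ((1 / a' - a') *\<^sub>R ((?P - ?P') *v v))" by (simp only: norm_triangle_ineq4)
  also have "norm ((a / a') *\<^sub>R (?P *v ?u) + (a' / a) *\<^sub>R (?u - ?P *v ?u)) \<le> m * norm ?u"
    by (rule norm_rank_one_combination_le[OF e]) (use a a' m in auto)
  also have "norm ((1 / a' - a') *\<^sub>R ((?P - ?P') *v v)) \<le> (1 / a') * (\<delta> * ((1 / a) * norm ?u))"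
  proof -
    have "a' * a' \<le> 1 * 1" using a' by (intro mult_mono) auto
    then have "\<bar>1 / a' - a'\<bar> \<le> 1 / a'" using a' by (simp add: field_simps)
    moreover have "norm ((?P - ?P') *v v) \<le> \<delta> * ((1 / a) * norm ?u)"
      using norm_matrix_vector_le_opnorm[of "?P - ?P'" v] 
        mult_left_mono[OF norm_gauge_transform_le(2)[OF e a, of v] opnorm_nonneg[of "?P - ?P'"]]
      unfolding \<delta>_def by linarith
    ultimately show ?thesis unfolding norm_scaleR using a' by (intro mult_mono) auto
  qed
  also have "m * norm ?u + (1 / a') * (\<delta> * ((1 / a) * norm ?u)) = (m + \<delta> / (a * a')) * norm ?u"
    using a a' by (simp add: field_simps)
  finally have le: "norm (gauge_transform a' e' v) \<le> (m + \<delta> / (a * a')) * norm ?u" by simp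
  have "m + \<delta> / (a * a') \<le> m * (1 + \<delta> / (a * a'))"
    using mult_right_mono[OF m(3) \<delta>] by (simp add: distrib_left)
  also have "\<dots> = exp (\<bar>ln (a' / a)\<bar> + ln (1 + \<delta> / (a * a')))"
    using \<delta> by (simp add: exp_add m_def)
  finally have "(m + \<delta> / (a * a')) * norm ?u \<le> exp (\<bar>ln (a' / a)\<bar> + ln (1 + \<delta> / (a * a'))) * norm ?u"
    by (rule mult_right_mono) simp
  with le have "norm (gauge_transform a' e' v) \<le> exp (\<bar>ln (a' / a)\<bar> + ln (1 + \<delta> / (a * a'))) * norm ?u"
    by (rule order_trans)
  then show ?thesis unfolding \<delta>_def by (subst mult.commute)
qed

text \<open>Steps and changes of gauge are chained across the N intervals and N - 1 junctions.
  Entering the first gauge from the Euclidean norm costs 1/a_0, leaving the last one costs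
  1/a_(N-1).\<close>

lemma opnorm_monodromy_le_gauge:
  assumes H: "canonical_system H L" and G: "finite_rank_hamiltonian L N x e G"
    and a: "\<And>j. j < N \<Longrightarrow> 0 < a j \<and> a j \<le> 1"
  shows "opnorm (monodromy H L z) \<le> exp (norm z * (\<Sum>j<N. (a j)\<^sup>2 * (x (Suc j) - x j))
    + norm z * (\<Sum>j<N. 1 / (a j)\<^sup>2 *
            integral\<^sup>L (lebesgue_on {x j..x (Suc j)}) (\<lambda>t. opnorm (H t - G t)))
    + (\<Sum>j<N - 1. ln (1 + opnorm (rank_one (e j) - rank_one (e (Suc j))) / (a j * a (Suc j))))
    + (ln (1 / a 0) + ln (1 / a (N - 1)) + (\<Sum>j\<in>{1..<N}. \<bar>ln (a j / a (j - 1))\<bar>)))"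
    (is "_ \<le> exp (?s1 + ?s2 + ?s3 + (?l0 + ?l1 + ?s4))")
proof -
  have L: "0 < L" using H by (simp add: canonical_system_def)
  have x0: "x 0 = 0" and xN: "x N = L" and xs: "\<And>j. j < N \<Longrightarrow> x j < x (Suc j)"
    and e: "\<And>j. j < N \<Longrightarrow> norm (e j) = 1"
    and Gr: "\<And>j t. j < N \<Longrightarrow> t \<in> {x j<..<x (Suc j)} \<Longrightarrow> G t = rank_one (e j)"
    using G by (auto simp: finite_rank_hamiltonian_def)
  have "N \<noteq> 0" using x0 xN L by (metis less_irrefl)
  then obtain n where n: "N = Suc n" by (cases N) auto
  have xmono: "x i \<le> x j" if "i \<le> j" "j \<le> N" for i j
    using that
  proof (induction j)
    case (Suc j)
    then show ?case using xs[of j] by (cases "i = Suc j") auto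
  qed simp
  obtain M where M: "ode_solution H L z M" using ode_solution_exists[OF H] .
  have M0: "M 0 = mat 1" using M L by (auto simp: linear_ode_solution_def)
  define E where "E j = norm z * ((a j)\<^sup>2 * (x (Suc j) - x j) + 1 / (a j)\<^sup>2 *
            integral\<^sup>L (lebesgue_on {x j..x (Suc j)}) (\<lambda>t. opnorm (H t - G t)))" for j
  define F where "F j = \<bar>ln (a (Suc j) / a j)\<bar>
      + ln (1 + opnorm (rank_one (e j) - rank_one (e (Suc j))) / (a j * a (Suc j)))" for j
  have "norm (M L *v v) \<le> exp (?s1 + ?s2 + ?s3 + (?l0 + ?l1 + ?s4)) * norm v" for v
  proof -
    let ?w = "\<lambda>j t. norm (gauge_transform (a j) (e j) (M t *v v))"
    have step: "?w j (x (Suc j)) \<le> ?w j (x j) * exp (E j)" if "j < N" for j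
      unfolding E_def
      by (rule gauge_transform_step[OF H M])
        (use that xmono[of 0 j] xmono[of "Suc j" N] xs[OF that] a e Gr x0 xN in auto)
    have "?w k (x (Suc k)) \<le> ?w 0 0 * exp ((\<Sum>j<Suc k. E j) + (\<Sum>j<k. F j))" if "k < N" for k
      using that
    proof (induction k)
      case 0 then show ?case using step[of 0] x0 by simp
    next
      case (Suc k)
      have "?w (Suc k) (x (Suc (Suc k))) \<le> ?w (Suc k) (x (Suc k)) * exp (E (Suc k))"
        using step Suc.prems by blast
      also have "?w (Suc k) (x (Suc k)) \<le> ?w k (x (Suc k)) * exp (F k)"
        unfolding F_def by (rule gauge_transform_change) (use a e Suc.prems in auto)
      also have "?w k (x (Suc k)) \<le> ?w 0 0 * exp ((\<Sum>j<Suc k. E j) + (\<Sum>j<k. F j))"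
        using Suc by simp
      finally show ?case by (simp add: exp_add mult_ac)
    qed
    from this[of n] have w: "?w n L \<le> ?w 0 0 * exp ((\<Sum>j<N. E j) + (\<Sum>j<n. F j))"
      using n xN by simp
    have "norm (M L *v v) \<le> (1 / a n) * ?w n L"
      by (rule norm_gauge_transform_le(2)) (use a[of n] e n in auto)
    also have "\<dots> \<le> (1 / a n) * (?w 0 0 * exp ((\<Sum>j<N. E j) + (\<Sum>j<n. F j)))"
      using w a[of n] n by (intro mult_left_mono) auto
    also have "\<dots> \<le> (1 / a n) * (((1 / a 0) * norm v) * exp ((\<Sum>j<N. E j) + (\<Sum>j<n. F j)))"
      using norm_gauge_transform_le(1)[of "e 0" "a 0" v] a[of n] a[of 0] e[of 0] n
      by (intro mult_left_mono mult_right_mono) (auto simp: M0)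
    also have "\<dots> = exp (?l0 + ?l1 + ((\<Sum>j<N. E j) + (\<Sum>j<n. F j))) * norm v"
      using a[of n] a[of 0] n by (simp add: exp_add mult_ac)
    also have "(\<Sum>j<N. E j) = ?s1 + ?s2"
      unfolding E_def by (simp add: sum.distrib sum_distrib_left distrib_left)
    also have "(\<Sum>j<n. F j) = ?s3 + ?s4"
    proof -
      have "?s4 = (\<Sum>j<n. \<bar>ln (a (Suc j) / a j)\<bar>)"
        unfolding n using sum.atLeast_Suc_lessThan_Suc_shift[of "\<lambda>j. \<bar>ln (a j / a (j - 1))\<bar>" 0 n]
        by (simp add: lessThan_atLeast0)
      then show ?thesis unfolding F_def by (simp add: sum.distrib n)
    qed
    finally show ?thesis by (simp add: algebra_simps)
  qed
  then show ?thesis unfolding monodromy_eq[OF H M] by (rule opnorm_le)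
qed

theorem finite_rank_approximable_growth:
  assumes H: "canonical_system H L" and d: "0 < d" "d < 1" and fr: "finite_rank_approximable H L d"
  shows "\<exists>K>0. \<forall>z. opnorm (monodromy H L z) \<le> exp (K * norm z powr d)"
proof -
  obtain C R0 where C: "C > 0" and R0: "\<And>R. R \<ge> R0 \<Longrightarrow> \<exists>N x e G a.
        finite_rank_hamiltonian L N x e G \<and>
        (\<forall>j<N. 0 < a j \<and> a j \<le> 1) \<and>
        (\<Sum>j<N. 1 / (a j)\<^sup>2 *
            integral\<^sup>L (lebesgue_on {x j..x (Suc j)}) (\<lambda>t. opnorm (H t - G t)))
          \<le> C * R powr (d - 1) \<and>
        (\<Sum>j<N. (a j)\<^sup>2 * (x (Suc j) - x j)) \<le> C * R powr (d - 1) \<and>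
        (\<Sum>j<N - 1. ln (1 + opnorm (rank_one (e j) - rank_one (e (Suc j))) / (a j * a (Suc j))))
          \<le> C * R powr d \<and>
        ln (1 / a 0) + ln (1 / a (N - 1)) + (\<Sum>j\<in>{1..<N}. \<bar>ln (a j / a (j - 1))\<bar>)
          \<le> C * R powr d"
    using fr unfolding finite_rank_approximable_def eventually_at_top_linorder by blast
  obtain c where c: "c > 0" "\<And>z. opnorm (monodromy H L z) \<le> exp (c * norm z)"
    using opnorm_monodromy_le[OF H] by blast
  define R1 where "R1 = max R0 1"
  \<comment> \<open>\<open>4 * C\<close> collects the four hypotheses for |z| \<ge>
    \<open>R1\<close>; the other entry handles smaller |z|, where |z| = |z|^(1-d) |z|^d.\<close>
  define K where "K = max (4 * C) (c * R1 powr (1 - d))"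
  have "opnorm (monodromy H L z) \<le> exp (K * norm z powr d)" for z
  proof (cases "norm z \<ge> R1")
    case True
    then have z: "norm z \<ge> R0" "norm z > 0" by (auto simp: R1_def)
    obtain N x e G a where *: "finite_rank_hamiltonian L N x e G" "\<forall>j<N. 0 < a j \<and> a j \<le> 1"
        "(\<Sum>j<N. 1 / (a j)\<^sup>2 *
            integral\<^sup>L (lebesgue_on {x j..x (Suc j)}) (\<lambda>t. opnorm (H t - G t)))
          \<le> C * norm z powr (d - 1)"
        "(\<Sum>j<N. (a j)\<^sup>2 * (x (Suc j) - x j)) \<le> C * norm z powr (d - 1)"
        "(\<Sum>j<N - 1. ln (1 + opnorm (rank_one (e j) - rank_one (e (Suc j))) / (a j * a (Suc j))))
          \<le> C * norm z powr d"
        "ln (1 / a 0) + ln (1 / a (N - 1)) + (\<Sum>j\<in>{1..<N}. \<bar>ln (a j / a (j - 1))\<bar>)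
          \<le> C * norm z powr d"
      using R0[OF z(1)] by blast
    have pw: "norm z * (C * norm z powr (d - 1)) = C * norm z powr d"
      using z(2) by (simp add: powr_diff)
    from opnorm_monodromy_le_gauge[OF H *(1), of a z] *(2)
    have "opnorm (monodromy H L z) \<le> exp (norm z * (\<Sum>j<N. (a j)\<^sup>2 * (x (Suc j) - x j))
    + norm z * (\<Sum>j<N. 1 / (a j)\<^sup>2 *
            integral\<^sup>L (lebesgue_on {x j..x (Suc j)}) (\<lambda>t. opnorm (H t - G t)))
    + (\<Sum>j<N - 1. ln (1 + opnorm (rank_one (e j) - rank_one (e (Suc j))) / (a j * a (Suc j))))
    + (ln (1 / a 0) + ln (1 / a (N - 1)) + (\<Sum>j\<in>{1..<N}. \<bar>ln (a j / a (j - 1))\<bar>)))"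
      by blast
    also have "\<dots> \<le> exp (C * norm z powr d + C * norm z powr d + C * norm z powr d + C * norm z powr d)"
      unfolding exp_le_cancel_iff
      by (intro add_mono mult_left_mono[OF *(4) norm_ge_zero, of z, unfolded pw]
          mult_left_mono[OF *(3) norm_ge_zero, of z, unfolded pw] *(5,6))
    also have "\<dots> = exp (4 * C * norm z powr d)" by simp
    also have "\<dots> \<le> exp (K * norm z powr d)" by (simp add: K_def mult_right_mono)
    finally show ?thesis .
  next
    case False
    have "c * norm z \<le> c * R1 powr (1 - d) * norm z powr d"
    proof (cases "z = 0")
      case z: False
      have "norm z = norm z powr (1 - d) * norm z powr d" using z by (simp add: powr_add[symmetric])
      also have "\<dots> \<le> R1 powr (1 - d) * norm z powr d"
        using False d by (intro mult_right_mono powr_mono2) auto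
      finally show ?thesis using c(1) by (simp add: mult.assoc)
    qed simp
    also have "\<dots> \<le> K * norm z powr d" by (intro mult_right_mono) (auto simp: K_def)
    finally show ?thesis using c(2)[of z] by (meson exp_le_cancel_iff order_trans)
  qed
  moreover have "K > 0" using C by (simp add: K_def less_max_iff_disj)
  ultimately show ?thesis by blast
qed

section \<open>A system of given order\<close>

text \<open>By P J P = 0 the component P Y is constant on the piece. Hence the right-hand side is
  constant there and Y is affine, so the transfer across a piece is explicit.\<close>

lemma ode_solution_rank_one_piece:
  assumes H: "canonical_system H L" and M: "ode_solution H L z M" and ab: "0 \<le> \<alpha>" "\<alpha> \<le> \<beta>" "\<beta> \<le> L"
    and e: "norm e = 1" and He: "\<And>t. t \<in> {\<alpha><..<\<beta>} \<Longrightarrow> H t = rank_one e"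
  shows "M \<beta> *v v = M \<alpha> *v v - (\<beta> - \<alpha>) *\<^sub>R (J *v (z *s (rank_one e *v (M \<alpha> *v v))))"
proof -
  let ?P = "rank_one e" and ?Y = "\<lambda>t. M t *v v"
  let ?K = "\<lambda>y. - (J *v (z *s (?P *v y)))"
  have neg: "A *v (- u) = - (A *v u)" for A :: "complex^2^2" and u
    using linear_neg[OF bounded_linear.linear[OF bounded_linear_matrix_vector_mult]] .
  have hi: "((\<lambda>t. ?K (?Y t)) has_integral ?Y x - ?Y \<alpha>) {\<alpha>..x}" if x: "x \<in> {\<alpha>..\<beta>}" for x
  proof (rule has_integral_spike[of "{\<alpha>, x}"])
    show "((\<lambda>t. coeff H z t *v ?Y t) has_integral ?Y x - ?Y \<alpha>) {\<alpha>..x}"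
      using ab x by (intro ode_solution_increment[OF H M]) auto
    fix t assume "t \<in> {\<alpha>..x} - {\<alpha>, x}"
    then have "H t = ?P" using x by (intro He) auto
    then show "?K (?Y t) = coeff H z t *v ?Y t" by (simp add: coeff_mult)
  qed simp
  have P: "?P *v ?Y x = ?P *v ?Y \<alpha>" if "x \<in> {\<alpha>..\<beta>}" for x
  proof -
    from has_integral_linear[OF hi[OF that] bounded_linear_matrix_vector_mult, of ?P]
    have "((\<lambda>t. 0) has_integral ?P *v (?Y x - ?Y \<alpha>)) {\<alpha>..x}"
      by (simp add: o_def neg rank_one_J_rank_one)
    then show ?thesis by (simp add: has_integral_0_eq matrix_vector_mult_diff_distrib)
  qed
  have "((\<lambda>t. ?K (?Y \<alpha>)) has_integral ?Y \<beta> - ?Y \<alpha>) {\<alpha>..\<beta>}"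
  proof (rule has_integral_eq)
    show "?K (?Y t) = ?K (?Y \<alpha>)" if "t \<in> {\<alpha>..\<beta>}" for t by (subst P[OF that]) (rule refl)
    show "((\<lambda>t. ?K (?Y t)) has_integral ?Y \<beta> - ?Y \<alpha>) {\<alpha>..\<beta>}" using ab by (intro hi) auto
  qed
  moreover have "((\<lambda>t. ?K (?Y \<alpha>)) has_integral (\<beta> - \<alpha>) *\<^sub>R ?K (?Y \<alpha>)) {\<alpha>..\<beta>}"
    using has_integral_const_real[of "?K (?Y \<alpha>)" \<alpha> \<beta>] ab by simp
  ultimately have "?Y \<beta> - ?Y \<alpha> = (\<beta> - \<alpha>) *\<^sub>R ?K (?Y \<alpha>)" by (rule has_integral_unique)
  then show ?thesis by (simp add: algebra_simps)
qed

lemma rank_one_entry: "rank_one e $ i $ j = complex_of_real (e $ i * e $ j)"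
proof -
  have "\<forall>i j. rank_one e $ i $ j = complex_of_real (e $ i * e $ j)"
    unfolding forall_2 by (simp add: rank_one_def matrix_def cdot_def cvec_def axis_def sum_2)
  then show ?thesis by blast
qed

lemma psd_rank_one: "psd (rank_one e)"
  unfolding psd_def
proof
  fix v
  have "cdot (rank_one e *v v) v = cdot v (cvec e) * cnj (cdot v (cvec e))"
    by (simp add: rank_one_apply cdot_def cvec_def sum_2 algebra_simps)
  also have "\<dots> = complex_of_real ((norm (cdot v (cvec e)))\<^sup>2)" by (rule complex_norm_square[symmetric])
  finally show "cdot (rank_one e *v v) v \<in> \<real>\<^sub>\<ge>\<^sub>0" by simp
qed

lemma trace_rank_one: "norm e = 1 \<Longrightarrow> trace (rank_one e) = 1"
proof -
  assume "norm e = 1"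
  then have "(e $ 1)\<^sup>2 + (e $ 2)\<^sup>2 = 1" by (simp add: norm_vec_def L2_set_def sum_2)
  then have "complex_of_real ((e $ 1)\<^sup>2 + (e $ 2)\<^sup>2) = 1" by simp
  then show ?thesis by (simp add: trace_def rank_one_entry sum_2 power2_eq_square)
qed

lemma opnorm_rank_one_diff_le:
  assumes "norm e = 1" "norm e' = 1"
  shows "opnorm (rank_one e - rank_one e') \<le> 2"
proof (rule opnorm_le)
  fix v
  have "norm ((rank_one e - rank_one e') *v v) \<le> norm (rank_one e *v v) + norm (rank_one e' *v v)"
    by (simp add: matrix_vector_mult_diff_rdistrib norm_triangle_ineq4)
  then show "norm ((rank_one e - rank_one e') *v v) \<le> 2 * norm v"
    using norm_rank_one_le[OF assms(1), of v] norm_rank_one_le[OF assms(2), of v] by linarith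
qed

section \<open>The alternating Hamiltonian with nodes accumulating at 1\<close>

definition dir :: "nat \<Rightarrow> real^2" where
  "dir k = (if even k then axis 1 1 else axis 2 1)"

definition node :: "real \<Rightarrow> nat \<Rightarrow> real" where
  "node b k = 1 - (real k + 1) powr (- b)"

text \<open>On \<open>{node b k<..<node b (Suc k)}\<close> the floor equals \<open>k + 1\<close>; this makes measurability
  immediate.\<close>

definition comb :: "real \<Rightarrow> real \<Rightarrow> complex^2^2" where
  "comb b t = rank_one (if even \<lfloor>(1 - t) powr (- 1 / b)\<rfloor> then axis 2 1 else axis 1 1)"

lemma norm_dir [simp]: "norm (dir k) = 1"
  by (simp add: dir_def)

lemma node_0 [simp]: "node b 0 = 0"
  by (simp add: node_def)

lemma node_less_1: "node b k < 1"
  by (simp add: node_def)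

lemma node_strict_mono: "b > 0 \<Longrightarrow> k < l \<Longrightarrow> node b k < node b l"
  by (simp add: node_def powr_less_mono2_neg)

lemma node_mono: "b > 0 \<Longrightarrow> k \<le> l \<Longrightarrow> node b k \<le> node b l"
  using node_strict_mono[of b k l] by (cases "k = l") auto

lemma node_nonneg: "b > 0 \<Longrightarrow> 0 \<le> node b k"
  using node_mono[of b 0 k] by simp

lemma node_tendsto: "b > 0 \<Longrightarrow> node b \<longlonglongrightarrow> 1"
proof -
  assume b: "b > 0"
  have "filterlim (\<lambda>k. 1 + real k) at_top sequentially"
    by (rule filterlim_tendsto_add_at_top[OF tendsto_const filterlim_real_sequentially])
  then have "filterlim (\<lambda>k. real k + 1) at_top sequentially" by (simp add: add.commute)
  then have "(\<lambda>k. (real k + 1) powr (- b)) \<longlonglongrightarrow> 0"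
    by (rule tendsto_neg_powr[rotated]) (use b in simp)
  then have "(\<lambda>k. 1 - (real k + 1) powr (- b)) \<longlonglongrightarrow> 1 - 0" by (intro tendsto_intros)
  then show ?thesis by (simp add: node_def[abs_def])
qed

lemma comb_eq:
  assumes b: "b > 0" and t: "t \<in> {node b k<..<node b (Suc k)}"
  shows "comb b t = rank_one (dir k)"
proof -
  have t1: "0 < 1 - t" using t node_less_1[of b "Suc k"] by auto
  have inv: "((real m) powr (- b)) powr (- 1 / b) = real m" for m :: nat
    using b by (simp add: powr_powr)
  have lo: "1 - t < (real (k + 1)) powr (- b)" and hi: "(real (k + 2)) powr (- b) < 1 - t"
    using t by (auto simp: node_def add.commute)
  have "(real (k + 1) powr (- b)) powr (- 1 / b) < (1 - t) powr (- 1 / b)"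
    using b t1 lo by (intro powr_less_mono2_neg) auto
  moreover have "(1 - t) powr (- 1 / b) < (real (k + 2) powr (- b)) powr (- 1 / b)"
    using b hi by (intro powr_less_mono2_neg) auto
  ultimately have "\<lfloor>(1 - t) powr (- 1 / b)\<rfloor> = int k + 1"
    unfolding inv by (intro floor_unique) auto
  then show ?thesis by (simp add: comb_def dir_def)
qed

lemma canonical_system_comb: "canonical_system (comb b) 1"
proof -
  let ?c = "\<lambda>i::int. rank_one (if even i then axis 2 1 else axis 1 1)"
  have "(\<lambda>t::real. \<lfloor>(1 - t) powr (- 1 / b)\<rfloor>) \<in> measurable borel (count_space UNIV)" by measurable
  then have "(\<lambda>t. ?c \<lfloor>(1 - t) powr (- 1 / b)\<rfloor>) \<in> borel_measurable borel"
    by (rule measurable_compose) simp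
  then have "comb b \<in> borel_measurable borel" by (simp add: comb_def[abs_def])
  then have m: "comb b \<in> borel_measurable (lebesgue_on {0..1})"
    by (simp add: measurable_completion measurable_restrict_space1)
  have "comb b absolutely_integrable_on {0..1}"
    by (rule measurable_bounded_by_integrable_imp_absolutely_integrable[OF m,
          where g="\<lambda>t. norm (?c 0) + norm (?c 1)"]) (auto simp: comb_def)
  then have "integrable (lebesgue_on {0..1}) (comb b)"
    by (simp add: integrable_restrict_space set_integrable_def)
  moreover have "AE x in lebesgue_on {0..1}. psd (comb b x) \<and> trace (comb b x) = 1"
    by (rule AE_I2) (simp add: comb_def psd_rank_one trace_rank_one)
  ultimately show ?thesis by (simp add: canonical_system_def)
qed

text \<open>Mean value theorem; the derivative of x^(-b) is smallest in modulus at the right end k +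
  2.\<close>

lemma node_diff_ge:
  assumes b: "b > 0"
  shows "b * (real k + 2) powr (- b - 1) \<le> node b (Suc k) - node b k"
proof -
  let ?f = "\<lambda>x::real. x powr (- b)"
  have "\<exists>x. real k + 1 < x \<and> x < real k + 2 \<and>
      ?f (real k + 2) - ?f (real k + 1) = (real k + 2 - (real k + 1)) * (- b * x powr (- b - 1))"
    by (rule MVT2) (auto intro!: derivative_eq_intros)
  then obtain x where x: "real k + 1 < x" "x < real k + 2"
    "?f (real k + 2) - ?f (real k + 1) = - b * x powr (- b - 1)" by auto
  have "(real k + 2) powr (- b - 1) \<le> x powr (- b - 1)"
    using x b by (intro powr_mono2') auto
  then have "b * (real k + 2) powr (- b - 1) \<le> b * x powr (- b - 1)" using b by (intro mult_left_mono) auto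
  also have "\<dots> = node b (Suc k) - node b k" using x(3) by (simp add: node_def add.commute)
  finally show ?thesis .
qed

text \<open>At \<open>z = iy\<close> the entries \<open>M\<^sub>1\<^sub>1\<close> and \<open>i M\<^sub>2\<^sub>1\<close> at the nodes are nonnegative and nondecreasing,
  and the first one doubles every second step as long as \<open>y\<close> times the step length is at least one.\<close>

lemma opnorm_monodromy_comb_ge:
  assumes b: "b > 0" and y: "y > 0" and m: "\<And>k. k < 2 * m \<Longrightarrow> 1 \<le> y * (node b (Suc k) - node b k)"
  shows "2 ^ m \<le> opnorm (monodromy (comb b) 1 (\<i> * complex_of_real y))"
proof -
  let ?z = "\<i> * complex_of_real y" and ?v = "axis 1 1 :: complex^2"
  note H = canonical_system_comb[of b]
  obtain M where M: "ode_solution (comb b) 1 ?z M" using ode_solution_exists[OF H] .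
  have M0: "M 0 = mat 1" using M by (auto simp: linear_ode_solution_def)
  define Y where "Y t = M t *v ?v" for t
  define l where "l k = node b (Suc k) - node b k" for k
  have l: "0 < l k" for k using node_strict_mono[OF b, of k "Suc k"] by (simp add: l_def)
  have stepY: "Y (node b (Suc k)) = Y (node b k) - l k *\<^sub>R (J *v (?z *s (rank_one (dir k) *v Y (node b k))))" for k
    unfolding Y_def l_def
    by (rule ode_solution_rank_one_piece[OF H M])
      (use node_nonneg[OF b] node_mono[OF b] node_less_1[of b "Suc k"] comb_eq[OF b] in auto)
  \<comment> \<open>\<open>J\<close> exchanges the two axes up to sign, so an even step changes only
    the second entry by a multiple of the first, and an odd step does the converse.\<close>
  have even_step: "Y (node b (Suc k)) $ 1 = Y (node b k) $ 1"
      "Y (node b (Suc k)) $ 2 = Y (node b k) $ 2 - l k *\<^sub>R (?z * Y (node b k) $ 1)" if "even k" for k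
    using that unfolding stepY
    by (simp_all add: dir_def rank_one_apply J_mult cdot_def cvec_def axis_def sum_2)
  have odd_step: "Y (node b (Suc k)) $ 1 = Y (node b k) $ 1 + l k *\<^sub>R (?z * Y (node b k) $ 2)"
      "Y (node b (Suc k)) $ 2 = Y (node b k) $ 2" if "odd k" for k
    using that unfolding stepY
    by (simp_all add: dir_def rank_one_apply J_mult cdot_def cvec_def axis_def sum_2)
  \<comment> \<open>The bound on w is demanded only at odd k, when w has just gained at least the
    current u; the next step adds at least w to u. The minimum freezes the bound on u after
    \<open>2 * m\<close> steps, beyond which only monotonicity is available.\<close>
  have ex: "\<exists>u w::real. Y (node b k) $ 1 = complex_of_real u \<and> Y (node b k) $ 2 = - \<i> * complex_of_real w \<and>
      0 \<le> w \<and> 2 ^ (min k (2 * m) div 2) \<le> u \<and> (odd k \<and> k \<le> 2 * m \<longrightarrow> 2 ^ (k div 2) \<le> w)" for k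
  proof (induction k)
    case 0
    show ?case by (rule exI[of _ 1], rule exI[of _ 0]) (simp add: Y_def M0 axis_def)
  next
    case (Suc k)
    then obtain u w where IH: "Y (node b k) $ 1 = complex_of_real u" "Y (node b k) $ 2 = - \<i> * complex_of_real w"
      "0 \<le> w" "2 ^ (min k (2 * m) div 2) \<le> u" "odd k \<and> k \<le> 2 * m \<longrightarrow> 2 ^ (k div 2) \<le> w" by blast
    have u: "0 \<le> u" using IH(4) by (meson order_trans zero_le_numeral zero_le_power)
    have yl: "0 \<le> y * l k" using y l[of k] by simp
    show ?case
    proof (cases "even k")
      case True
      let ?w = "w + y * l k * u"
      have w: "0 \<le> ?w" using IH(3) u yl by simp
      have "2 ^ (Suc k div 2) \<le> ?w" if "Suc k \<le> 2 * m"
      proof -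
        have "1 * u \<le> y * l k * u" using m[of k] that u by (intro mult_right_mono) (auto simp: l_def)
        moreover have "Suc k div 2 = k div 2" using True by simp
        moreover have "2 ^ (k div 2) \<le> u" using IH(4) that by (simp add: min_def)
        ultimately show ?thesis using IH(3) by simp
      qed
      moreover have "2 ^ (min (Suc k) (2 * m) div 2) \<le> u"
      proof -
        have "min (Suc k) (2 * m) div 2 = min k (2 * m) div 2" using True by (auto simp: min_def)
        then show ?thesis using IH(4) by simp
      qed
      moreover have "Y (node b (Suc k)) $ 2 = - \<i> * complex_of_real ?w"
        unfolding even_step(2)[OF True] IH(1,2) by (simp add: scaleR_conv_of_real algebra_simps)
      ultimately show ?thesis using w IH(1) even_step(1)[OF True] True
        by (intro exI[of _ u] exI[of _ ?w]) auto
    next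
      case False
      let ?u = "u + y * l k * w"
      have "2 ^ (min (Suc k) (2 * m) div 2) \<le> ?u"
      proof (cases "Suc k \<le> 2 * m")
        case True
        have "1 * w \<le> y * l k * w" using m[of k] True IH(3) by (intro mult_right_mono) (auto simp: l_def)
        moreover have "2 ^ (k div 2) \<le> w" "2 ^ (k div 2) \<le> u" using IH(4,5) False True by (auto simp: min_def)
        moreover have "Suc k div 2 = Suc (k div 2)" using False by simp
        ultimately show ?thesis using True by simp
      next
        case F: False
        then have "min (Suc k) (2 * m) = min k (2 * m)" by simp
        then show ?thesis using IH(3,4) yl by (simp add: add_increasing2)
      qed
      moreover have "Y (node b (Suc k)) $ 1 = complex_of_real ?u"
        unfolding odd_step(1)[OF False] IH(1,2) by (simp add: scaleR_conv_of_real algebra_simps)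
      ultimately show ?thesis using IH(2,3) odd_step(2)[OF False] False
        by (intro exI[of _ ?u] exI[of _ w]) auto
    qed
  qed
  have big: "2 ^ m \<le> norm (Y (node b k))" if "2 * m \<le> k" for k
  proof -
    obtain u :: real where "Y (node b k) $ 1 = complex_of_real u" "2 ^ (min k (2 * m) div 2) \<le> u" using ex[of k] by blast
    then have "2 ^ m \<le> norm (Y (node b k) $ 1)" using that by (simp add: min_absorb2)
    then show ?thesis using Finite_Cartesian_Product.norm_nth_le[of "Y (node b k)" 1] by simp
  qed
  \<comment> \<open>The endpoint 1 is not a node but the limit of the nodes, so the bound reaches it
    by continuity.\<close>
  have "continuous_on {0..1} Y" unfolding Y_def[abs_def] by (rule ode_solution_continuous[OF M])
  then have "(\<lambda>k. Y (node b k)) \<longlonglongrightarrow> Y 1"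
    by (rule continuous_on_tendsto_compose[OF _ node_tendsto[OF b]])
      (auto intro!: always_eventually simp: node_nonneg[OF b] less_imp_le[OF node_less_1])
  then have "(\<lambda>k. norm (Y (node b k))) \<longlonglongrightarrow> norm (Y 1)" by (rule tendsto_norm)
  then have "2 ^ m \<le> norm (Y 1)" by (rule LIMSEQ_le_const) (use big in blast)
  also have "\<dots> \<le> opnorm (M 1) * norm ?v" unfolding Y_def by (rule norm_matrix_vector_le_opnorm)
  finally show ?thesis by (simp add: monodromy_eq[OF H M])
qed

section \<open>From growth bounds to the order\<close>

lemma eventually_le_powr:
  fixes c s :: real
  assumes "s > 0"
  shows "\<forall>\<^sub>F r in at_top. c \<le> r powr s"
  using eventually_ge_at_top[of "max 1 c powr (1 / s)"]
proof eventually_elim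
  case (elim r)
  have "c \<le> (max 1 c powr (1 / s)) powr s" using assms by (simp add: powr_powr)
  also have "\<dots> \<le> r powr s" using elim assms by (intro powr_mono2) auto
  finally show ?case .
qed

text \<open>The gap between \<open>q0\<close> and \<open>q\<close> absorbs the constant: eventually
  \<open>K\<close> is at most |z|^(q - q0).\<close>

lemma entire_order_le:
  assumes K: "K > 0" and q: "0 < q0" "q0 < q"
    and le: "\<And>z. opnorm (F z) \<le> exp (K * norm z powr q0)"
  shows "entire_order F \<le> ereal q"
proof -
  have "filterlim (\<lambda>z::complex. norm z) at_top at_infinity" by (rule filterlim_norm_at_top)
  moreover have "\<forall>\<^sub>F r::real in at_top. r > 1 \<and> K \<le> r powr (q - q0)"
    using q by (intro eventually_conj eventually_gt_at_top eventually_le_powr) simp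
  ultimately have "\<forall>\<^sub>F z::complex in at_infinity. norm z > 1 \<and> K \<le> norm z powr (q - q0)"
    by (rule eventually_compose_filterlim[rotated])
  then have ev: "\<forall>\<^sub>F z in at_infinity. (if opnorm (F z) > 1 then ereal (ln (ln (opnorm (F z))) / ln (norm z)) else -\<infinity>) \<le> ereal q"
  proof eventually_elim
    case (elim z)
    show ?case
    proof (cases "opnorm (F z) > 1")
      case True
      have "ln (opnorm (F z)) \<le> ln (exp (K * norm z powr q0))" using le[of z] True by (subst ln_le_cancel_iff) auto
      also have "\<dots> \<le> norm z powr (q - q0) * norm z powr q0" using elim by (simp add: mult_right_mono)
      also have "\<dots> = norm z powr q" by (simp add: powr_add[symmetric])
      finally have "ln (ln (opnorm (F z))) \<le> ln (norm z powr q)" using True by (subst ln_le_cancel_iff) auto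
      also have "\<dots> = q * ln (norm z)" using elim by (simp add: ln_powr)
      finally have "ln (ln (opnorm (F z))) \<le> q * ln (norm z)" .
      moreover have "0 < ln (norm z)" using elim by (intro ln_gt_zero) simp
      ultimately show ?thesis using True by (simp add: pos_divide_le_eq)
    qed simp
  qed
  show ?thesis unfolding entire_order_def using q by (intro max.boundedI Limsup_bounded ev) auto
qed

text \<open>An upper limit at infinity is not smaller than the upper limit along one path to
  infinity, here the positive imaginary axis.\<close>

lemma entire_order_ge:
  assumes ev: "\<forall>\<^sub>F y::real in at_top. exp (y powr q) \<le> opnorm (F (\<i> * complex_of_real y))"
  shows "ereal q \<le> entire_order F"
proof -
  let ?f = "\<lambda>z. if opnorm (F z) > 1 then ereal (ln (ln (opnorm (F z))) / ln (norm z)) else -\<infinity>"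
  have "ereal q \<le> Limsup at_infinity ?f"
  proof (rule ccontr)
    assume "\<not> ereal q \<le> Limsup at_infinity ?f"
    then have "\<forall>\<^sub>F z in at_infinity. ?f z < ereal q" by (intro Limsup_lessD) simp
    moreover have "filterlim (\<lambda>y. \<i> * complex_of_real y) at_infinity at_top"
      unfolding filterlim_at_infinity_conv_norm_at_top
      by (simp add: norm_mult filterlim_abs_real)
    ultimately have "\<forall>\<^sub>F y in at_top. ?f (\<i> * complex_of_real y) < ereal q"
      by (rule eventually_compose_filterlim)
    with ev eventually_gt_at_top[of "1::real"] have "\<forall>\<^sub>F y::real in at_top. False"
    proof eventually_elim
      case (elim y)
      let ?o = "opnorm (F (\<i> * complex_of_real y))"
      have p: "0 < y powr q" using elim by simp
      then have "1 < exp (y powr q)" by simp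
      with elim have o1: "1 < ?o" by linarith
      have "ln (exp (y powr q)) \<le> ln ?o" using elim o1 by (subst ln_le_cancel_iff) auto
      then have "ln (y powr q) \<le> ln (ln ?o)" using p o1 by (subst ln_le_cancel_iff) simp_all
      then have "q * ln y \<le> ln (ln ?o)" using elim by (simp add: ln_powr)
      then have "q \<le> ln (ln ?o) / ln y" using elim by (simp add: field_simps)
      moreover have "ln (ln ?o) / ln y < q" using elim o1 by (simp add: norm_mult)
      ultimately show ?case by simp
    qed
    then show False by (simp add: trivial_limit_at_top_linorder)
  qed
  then show ?thesis unfolding entire_order_def by (simp add: le_max_iff_disj)
qed

text \<open>Since p (b + 1) = 1, the condition k + 2 \<le> (b y)^p is equivalent to y b (k +
  2)^(-b-1) \<ge> 1. So about (b y)^p / 2 doublings occur, and y^q with q < p is of smaller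
  order.\<close>

lemma comb_growth:
  assumes b: "b > 0" and p: "p = 1 / (b + 1)" and q: "q < p"
  shows "\<forall>\<^sub>F y::real in at_top. exp (y powr q) \<le> opnorm (monodromy (comb b) 1 (\<i> * complex_of_real y))"
proof -
  have p0: "0 < p" using b p by simp
  have 1: "\<forall>\<^sub>F y::real in at_top. y powr q \<le> (((b * y) powr p - 3) / 2) * ln 2"
  proof -
    let ?c = "b powr p / 4 * ln 2"
    have c: "?c > 0" using b by simp
    have "\<forall>\<^sub>F y::real in at_top. 1 / ?c \<le> y powr (p - q)"
      using q by (intro eventually_le_powr) simp
    \<comment> \<open>The 6 comes from comparing with the rounded number of doublings: X/4 \<le> (X
      - 3)/2 holds exactly for X \<ge> 6, with X = (b y)^p.\<close>
    moreover have "\<forall>\<^sub>F y::real in at_top. 6 / b powr p \<le> y powr p"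
      using p0 by (rule eventually_le_powr)
    ultimately show ?thesis using eventually_gt_at_top[of "0::real"]
    proof eventually_elim
      case (elim y)
      have "1 \<le> y powr (p - q) * ?c" using elim(1) c by (simp add: divide_le_eq)
      then have "y powr q * 1 \<le> y powr q * (y powr (p - q) * ?c)" by (intro mult_left_mono) auto
      also have "\<dots> = (y powr q * y powr (p - q)) * ?c" by (simp only: mult.assoc)
      also have "y powr q * y powr (p - q) = y powr p" by (simp add: powr_add[symmetric])
      also have "y powr p * ?c = (b * y) powr p / 4 * ln 2" using b elim by (simp add: powr_mult)
      also have "\<dots> \<le> (((b * y) powr p - 3) / 2) * ln 2"
      proof (rule mult_right_mono)
        have "6 \<le> y powr p * b powr p" using elim(2) b by (simp add: divide_le_eq)
        then have "6 \<le> (b * y) powr p" using b elim by (simp add: powr_mult mult.commute)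
        then show "(b * y) powr p / 4 \<le> ((b * y) powr p - 3) / 2" by simp
      qed simp
      finally show ?case by simp
    qed
  qed
  from 1 eventually_gt_at_top[of "0::real"] show ?thesis
  proof eventually_elim
    case (elim y)
    \<comment> \<open>For k < 2 m this choice gives k + 2 \<le> 2 m + 1 \<le> (b y)^p. The floor
      loses less than 1, whence the 3 in the lower bound for m.\<close>
    define m where "m = nat \<lfloor>((b * y) powr p - 1) / 2\<rfloor>"
    have "0 \<le> y powr q" by simp
    then have "0 \<le> (((b * y) powr p - 3) / 2) * ln 2" using elim(1) by linarith
    then have "3 \<le> (b * y) powr p" by (simp add: zero_le_mult_iff)
    then have "real m = of_int \<lfloor>((b * y) powr p - 1) / 2\<rfloor>" by (simp add: m_def)
    then have m: "2 * real m + 1 \<le> (b * y) powr p" "((b * y) powr p - 3) / 2 \<le> real m"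
      using of_int_floor_le[of "((b * y) powr p - 1) / 2"]
        real_of_int_floor_gt_diff_one[of "((b * y) powr p - 1) / 2"] by (simp_all add: field_simps)
    have "2 ^ m \<le> opnorm (monodromy (comb b) 1 (\<i> * complex_of_real y))"
    proof (rule opnorm_monodromy_comb_ge[OF b elim(2)])
      fix k assume "k < 2 * m"
      then have "real k + 1 \<le> 2 * real m" by linarith
      then have k: "real k + 2 \<le> (b * y) powr p" using m(1) by linarith
      have "p * (- b - 1) = - 1" using b p by (simp add: field_simps)
      then have "(b * y) powr (- 1) = ((b * y) powr p) powr (- b - 1)" by (simp add: powr_powr)
      also have "\<dots> \<le> (real k + 2) powr (- b - 1)" using k b by (intro powr_mono2') auto
      finally have "1 \<le> y * (b * (real k + 2) powr (- b - 1))"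
        using b elim(2) by (simp add: powr_minus field_simps)
      also have "\<dots> \<le> y * (node b (Suc k) - node b k)"
        using node_diff_ge[OF b, of k] elim(2) by (intro mult_left_mono) auto
      finally show "1 \<le> y * (node b (Suc k) - node b k)" .
    qed
    moreover have "exp (y powr q) \<le> exp (real m * ln 2)"
      unfolding exp_le_cancel_iff by (rule order_trans[OF elim(1) mult_right_mono[OF m(2)]]) simp
    moreover have "exp (real m * ln 2) = (2::real) ^ m" by (simp add: exp_of_nat_mult)
    ultimately show ?case by simp
  qed
qed

text \<open>The approximants keep the first \<open>n\<close> steps of \<open>comb\<close>, with the same small gauge parameter on
  all of them, and replace the rest by a single step with gauge parameter \<open>1\<close>.\<close>

lemma finite_rank_approximable_comb:
  assumes b: "b > 0" and p: "p = 1 / (b + 1)" and \<epsilon>: "\<epsilon> > 0" and d: "d = p + \<epsilon>" "d < 1"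
  shows "finite_rank_approximable (comb b) 1 d"
proof -
  have p0: "0 < p" using b p by simp
  then have d0: "0 < d" using \<epsilon> d by simp
  \<comment> \<open>The entry 2 serves (i) and (ii), the next one (iii), the last one (iv).\<close>
  define C where "C = max 2 (max (2 * 3 powr \<epsilon> / \<epsilon>) (1 / d))"
  have "C > 0" by (simp add: C_def)
  have "\<forall>\<^sub>F R::real in at_top. \<exists>N x e G a.
        finite_rank_hamiltonian 1 N x e G \<and>
        (\<forall>j<N. 0 < a j \<and> a j \<le> 1) \<and>
        (\<Sum>j<N. 1 / (a j)\<^sup>2 *
            integral\<^sup>L (lebesgue_on {x j..x (Suc j)}) (\<lambda>t. opnorm (comb b t - G t)))
          \<le> C * R powr (d - 1) \<and>
        (\<Sum>j<N. (a j)\<^sup>2 * (x (Suc j) - x j)) \<le> C * R powr (d - 1) \<and>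
        (\<Sum>j<N - 1. ln (1 + opnorm (rank_one (e j) - rank_one (e (Suc j))) / (a j * a (Suc j))))
          \<le> C * R powr d \<and>
        ln (1 / a 0) + ln (1 / a (N - 1)) + (\<Sum>j\<in>{1..<N}. \<bar>ln (a j / a (j - 1))\<bar>)
          \<le> C * R powr d"
    using eventually_ge_at_top[of "1::real"]
  proof eventually_elim
    case (elim R)
    define n where "n = nat \<lceil>R powr p\<rceil>"
    have Rp: "1 \<le> R powr p" using elim p0 by (simp add: ge_one_powr_ge_zero)
    have n: "R powr p \<le> real n" "real n \<le> 2 * R powr p" "0 < n"
      using Rp unfolding n_def by linarith+
    \<comment> \<open>The kept steps have total length below 1, so the squared parameter R^(d-1) is
      just small enough for (ii).\<close>
    define \<alpha> where "\<alpha> = R powr ((d - 1) / 2)"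
    have \<alpha>: "0 < \<alpha>" "\<alpha> \<le> 1" "\<alpha>\<^sup>2 = R powr (d - 1)"
      using elim d powr_mono[of "(d - 1) / 2" 0 R]
      by (auto simp: \<alpha>_def power2_eq_square powr_add[symmetric])
    have ln\<alpha>: "ln \<alpha> = (d - 1) / 2 * ln R" using elim by (simp add: \<alpha>_def ln_powr)
    define x where "x j = (if j \<le> n then node b j else 1)" for j
    \<comment> \<open>The parameter is small only where the approximant is exact and (i) has nothing
      to amplify. On the last step the error is not controlled, so its weight in (i) is kept at 1;
      there (ii) holds because that step is short.\<close>
    define a where "a j = (if j < n then \<alpha> else 1)" for j
    define G where "G t = (if t \<le> node b n then comb b t else rank_one (dir n))" for t
    have a01: "0 < a j" "a j \<le> 1" for j using \<alpha> by (auto simp: a_def)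
    have tail: "1 - node b n \<le> R powr (d - 1)"
    proof -
      have "1 - node b n = (real n + 1) powr (- b)" by (simp add: node_def)
      also have "\<dots> \<le> (R powr p) powr (- b)" using n Rp b by (intro powr_mono2') auto
      also have "\<dots> = R powr (p - 1)"
      proof -
        have "p * (- b) = p - 1" using b p by (simp add: field_simps)
        then show ?thesis unfolding powr_powr by (rule arg_cong)
      qed
      also have "\<dots> \<le> R powr (d - 1)" using elim \<epsilon> d by (intro powr_mono) auto
      finally show ?thesis .
    qed
    have R0: "0 \<le> R powr (d - 1)" "0 \<le> R powr d" by simp_all
    have C: "2 * R powr (d - 1) \<le> C * R powr (d - 1)" "1 / d * R powr d \<le> C * R powr d"
      "2 * 3 powr \<epsilon> / \<epsilon> * R powr d \<le> C * R powr d"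
      by (intro mult_right_mono; simp add: C_def)+
    have fr: "finite_rank_hamiltonian 1 (Suc n) x dir G"
      unfolding finite_rank_hamiltonian_def
    proof (intro conjI allI impI ballI)
      fix j assume j: "j < Suc n"
      show "x j < x (Suc j)" using j node_strict_mono[OF b, of j "Suc j"] node_less_1 by (auto simp: x_def)
      fix t assume t: "t \<in> {x j<..<x (Suc j)}"
      show "G t = rank_one (dir j)"
      proof (cases "j < n")
        case True
        then have t': "t \<in> {node b j<..<node b (Suc j)}" using t by (simp add: x_def)
        moreover have "t \<le> node b n" using t' node_mono[OF b, of "Suc j" n] True by auto
        ultimately show ?thesis by (simp add: G_def comb_eq[OF b])
      next
        case False
        then have "j = n" using j by simp
        then show ?thesis using t by (simp add: x_def G_def)
      qed
    qed (simp_all add: x_def)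
    let ?I = "\<lambda>j. integral\<^sup>L (lebesgue_on {x j..x (Suc j)}) (\<lambda>t. opnorm (comb b t - G t))"
    have I0: "?I j = 0" if "j < n" for j
    proof -
      have "?I j = integral\<^sup>L (lebesgue_on {x j..x (Suc j)}) (\<lambda>t. 0)"
      proof (rule Bochner_Integration.integral_cong[OF refl])
        fix t assume "t \<in> space (lebesgue_on {x j..x (Suc j)})"
        then have "t \<le> node b n" using that node_mono[OF b, of "Suc j" n] by (simp add: x_def)
        then show "opnorm (comb b t - G t) = 0" by (simp add: G_def opnorm_0)
      qed
      then show ?thesis by simp
    qed
    have In: "?I n \<le> 2 * (1 - node b n)"
    proof -
      have "?I n \<le> integral\<^sup>L (lebesgue_on {node b n..1}) (\<lambda>t. 2)"
      proof -
        have "x n = node b n" "x (Suc n) = 1" by (simp_all add: x_def)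
        then show ?thesis
          by (simp only:) (rule Bochner_Integration.integral_mono',
            auto simp: G_def comb_def opnorm_rank_one_diff_le opnorm_0)
      qed
      also have "\<dots> = 2 * (1 - node b n)" using node_less_1[of b n] by (simp add: measure_restrict_space)
      finally show ?thesis .
    qed
    have i: "(\<Sum>j<Suc n. 1 / (a j)\<^sup>2 * ?I j) \<le> C * R powr (d - 1)"
    proof -
      have "(\<Sum>j<Suc n. 1 / (a j)\<^sup>2 * ?I j) = ?I n" by (simp add: I0 a_def)
      also have "\<dots> \<le> 2 * (1 - node b n)" by (rule In)
      also have "\<dots> \<le> 2 * R powr (d - 1)" using tail by simp
      also note C(1)
      finally show ?thesis .
    qed
    have ii: "(\<Sum>j<Suc n. (a j)\<^sup>2 * (x (Suc j) - x j)) \<le> C * R powr (d - 1)"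
    proof -
      have "(\<Sum>j<n. (a j)\<^sup>2 * (x (Suc j) - x j)) = (\<Sum>j<n. \<alpha>\<^sup>2 * (node b (Suc j) - node b j))"
        by (rule sum.cong) (auto simp: a_def x_def)
      also have "\<dots> = \<alpha>\<^sup>2 * node b n"
        using sum_lessThan_telescope[of "node b" n] by (simp add: sum_distrib_left[symmetric])
      also have "\<dots> \<le> \<alpha>\<^sup>2 * 1" using node_less_1[of b n] by (intro mult_left_mono) auto
      finally show ?thesis using tail C(1) by (simp add: \<alpha>(3)) (simp add: a_def x_def)
    qed
    have iii: "(\<Sum>j<Suc n - 1. ln (1 + opnorm (rank_one (dir j) - rank_one (dir (Suc j))) / (a j * a (Suc j))))
          \<le> C * R powr d"
    proof -
      \<comment> \<open>Each junction costs a multiple of log R, traded here for R^\<epsilon>; times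
        the R^p junctions this is R^d.\<close>
      have term_le: "ln (1 + opnorm (rank_one (dir j) - rank_one (dir (Suc j))) / (a j * a (Suc j)))
          \<le> 3 powr \<epsilon> / \<epsilon> * R powr \<epsilon>" for j
      proof -
        let ?o = "opnorm (rank_one (dir j) - rank_one (dir (Suc j)))"
        have aa: "\<alpha>\<^sup>2 \<le> a j * a (Suc j)"
          unfolding power2_eq_square using \<alpha> by (intro mult_mono) (auto simp: a_def)
        have "?o / (a j * a (Suc j)) \<le> 2 / \<alpha>\<^sup>2"
          using aa \<alpha>(1) opnorm_rank_one_diff_le[of "dir j" "dir (Suc j)"] opnorm_nonneg by (intro frac_le) auto
        also have "\<dots> = 2 * R powr (1 - d)" using elim by (simp add: \<alpha>(3) powr_diff)
        also have "\<dots> \<le> 2 * R" using elim d0 powr_mono[of "1 - d" 1 R] by simp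
        finally have "1 + ?o / (a j * a (Suc j)) \<le> 3 * R" using elim by linarith
        moreover have "0 \<le> ?o / (a j * a (Suc j))"
          using a01[of j] a01[of "Suc j"] opnorm_nonneg by (intro divide_nonneg_pos) auto
        ultimately have "ln (1 + ?o / (a j * a (Suc j))) \<le> ln (3 * R)" by (subst ln_le_cancel_iff) auto
        also have "\<dots> \<le> (3 * R) powr \<epsilon> / \<epsilon>" using elim \<epsilon> by (intro ln_powr_bound) auto
        also have "\<dots> = 3 powr \<epsilon> / \<epsilon> * R powr \<epsilon>" using elim by (simp add: powr_mult)
        finally show ?thesis .
      qed
      have "(\<Sum>j<Suc n - 1. ln (1 + opnorm (rank_one (dir j) - rank_one (dir (Suc j))) / (a j * a (Suc j))))
         \<le> real (card {..<Suc n - 1}) * (3 powr \<epsilon> / \<epsilon> * R powr \<epsilon>)"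
        by (rule sum_bounded_above) (rule term_le)
      also have "\<dots> = real n * (3 powr \<epsilon> / \<epsilon> * R powr \<epsilon>)" by simp
      also have "\<dots> \<le> (2 * R powr p) * (3 powr \<epsilon> / \<epsilon> * R powr \<epsilon>)"
        using n(2) \<epsilon> by (intro mult_right_mono) auto
      also have "\<dots> = 2 * 3 powr \<epsilon> / \<epsilon> * R powr d" by (simp add: d powr_add)
      finally show ?thesis using C(3) by linarith
    qed
    have iv: "ln (1 / a 0) + ln (1 / a (Suc n - 1)) + (\<Sum>j\<in>{1..<Suc n}. \<bar>ln (a j / a (j - 1))\<bar>) \<le> C * R powr d"
    proof -
      \<comment> \<open>The parameter jumps only from step n - 1 to step n. This jump and the left
        end contribute - ln \<alpha> each, the right end nothing.\<close>
      have "{1..<Suc n} = insert n {1..<n}" using n(3) by auto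
      then have "(\<Sum>j\<in>{1..<Suc n}. \<bar>ln (a j / a (j - 1))\<bar>) = \<bar>ln (a n / a (n - 1))\<bar> + (\<Sum>j\<in>{1..<n}. \<bar>ln (a j / a (j - 1))\<bar>)"
        by simp
      also have "(\<Sum>j\<in>{1..<n}. \<bar>ln (a j / a (j - 1))\<bar>) = 0"
        using \<alpha>(1) by (intro sum.neutral) (auto simp: a_def)
      also have "\<bar>ln (a n / a (n - 1))\<bar> = \<bar>ln \<alpha>\<bar>" using n(3) \<alpha>(1) by (simp add: a_def ln_div)
      also have "\<bar>ln \<alpha>\<bar> = - ln \<alpha>" using \<alpha> by simp
      finally have "ln (1 / a 0) + ln (1 / a (Suc n - 1)) + (\<Sum>j\<in>{1..<Suc n}. \<bar>ln (a j / a (j - 1))\<bar>) = - 2 * ln \<alpha>"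
        using n(3) \<alpha>(1) by (simp add: a_def ln_div)
      also have "\<dots> = (1 - d) * ln R" by (simp add: ln\<alpha> field_simps)
      also have "\<dots> \<le> 1 * ln R" using d0 elim by (intro mult_right_mono) auto
      also have "\<dots> \<le> 1 / d * R powr d" using ln_powr_bound[OF elim d0] by simp
      finally show ?thesis using C(2) by linarith
    qed
    show ?case
      using fr a01 i ii iii iv by (intro exI[of _ "Suc n"] exI[of _ x] exI[of _ dir] exI[of _ G] exI[of _ a]) blast
  qed
  with \<open>C > 0\<close> show ?thesis unfolding finite_rank_approximable_def by blast
qed

lemma system_order_comb:
  assumes b: "b > 0" and p: "p = 1 / (b + 1)"
  shows "system_order (comb b) 1 = ereal p"
proof (rule antisym)
  have p01: "0 < p" "p < 1" using b p by simp_all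
  show "system_order (comb b) 1 \<le> ereal p"
  proof (rule dense_ge)
    fix u assume "ereal p < u"
    then obtain q' where q': "ereal p < ereal q'" "ereal q' < u" using ereal_dense2 by blast
    \<comment> \<open>Capped at (p + 1)/2 because the growth theorem takes exponents below 1
      only.\<close>
    define q where "q = min q' ((p + 1) / 2)"
    have q: "p < q" "q < 1" "ereal q \<le> u"
      using q' p01 by (auto simp: q_def min_def intro: less_imp_le order_trans[of _ "ereal q'"])
    \<comment> \<open>The midpoint of p and q leaves a gap on both sides: the approximation needs an
      exponent strictly above p, \<open>entire_order_le\<close> one strictly below q.\<close>
    have "0 < (q - p) / 2" "(p + q) / 2 = p + (q - p) / 2" "(p + q) / 2 < 1"
      using q(1,2) by (simp_all add: field_simps)
    then have "finite_rank_approximable (comb b) 1 ((p + q) / 2)"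
      by (rule finite_rank_approximable_comb[OF b p])
    then obtain K where K: "K > 0" "\<And>z. opnorm (monodromy (comb b) 1 z) \<le> exp (K * norm z powr ((p + q) / 2))"
      using finite_rank_approximable_growth[OF canonical_system_comb, of "(p + q) / 2" b] p01 q by auto
    have "system_order (comb b) 1 \<le> ereal q"
      unfolding system_order_def by (rule entire_order_le[OF K(1) _ _ K(2)]) (use p01 q in auto)
    with q(3) show "system_order (comb b) 1 \<le> u" by order
  qed
  show "ereal p \<le> system_order (comb b) 1"
  proof (rule dense_le)
    fix u assume u: "u < ereal p"
    then obtain q where q: "u < ereal q" "ereal q < ereal p" using ereal_dense2 by blast
    then have "ereal q \<le> system_order (comb b) 1"
      unfolding system_order_def by (intro entire_order_ge comb_growth[OF b p]) simp
    with q show "u \<le> system_order (comb b) 1" by order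
  qed
qed

theorem theorem1:
  shows "(\<forall>H L d. canonical_system H L \<and> 0 < d \<and> d < 1 \<and> finite_rank_approximable H L d \<longrightarrow>
            (\<exists>K>0. \<forall>z. opnorm (monodromy H L z) \<le> exp (K * norm z powr d))) \<and>
         (\<forall>p::real. 0 < p \<and> p < 1 \<longrightarrow>
            (\<exists>H L. canonical_system H L \<and> system_order H L = ereal p \<and>
               (\<forall>\<epsilon>>0. p + \<epsilon> < 1 \<longrightarrow> finite_rank_approximable H L (p + \<epsilon>))))"
proof (intro conjI allI impI)
  fix H L d
  assume "canonical_system H L \<and> 0 < d \<and> d < 1 \<and> finite_rank_approximable H L d"
  then show "\<exists>K>0. \<forall>z. opnorm (monodromy H L z) \<le> exp (K * norm z powr d)"
    using finite_rank_approximable_growth by blast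
next
  fix p :: real
  assume p: "0 < p \<and> p < 1"
  define b where "b = 1 / p - 1"
  have b: "b > 0" "p = 1 / (b + 1)" using p by (simp_all add: b_def)
  show "\<exists>H L. canonical_system H L \<and> system_order H L = ereal p \<and>
               (\<forall>\<epsilon>>0. p + \<epsilon> < 1 \<longrightarrow> finite_rank_approximable H L (p + \<epsilon>))"
    using canonical_system_comb system_order_comb[OF b] finite_rank_approximable_comb[OF b] by blast
qed

end
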